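(* Let $G$ be a graph of order $n$ such that both $G$ and its complement $\overline{G}$ are connected. Then $n-2\leq rd(G)+rd(\overline{G})\leq 2n-5$ and $n-3\leq rd(G)\cdot rd(\overline{G})\leq (n-2)(n-3)$. Furthermore, the bounds are sharp: the lower bounds are attained by $G=\overline{G}=P_4$, and for every $n\geq 6$ there is a graph $G$ of order $n$ with $G$ and $\overline{G}$ connected attaining both upper bounds.
   Context: All graphs are simple, finite and undirected; $P_4$ is the path on 4 vertices. For an edge-coloring of $G$ (adjacent edges may receive the same color), an edge-cut $R$ is a rainbow cut if no two edges of $R$ have the same color; it is a $u$-$v$ rainbow cut if $u$ and $v$ lie in different components of $G-R$. $G$ is rainbow disconnected if every two vertices $u,v$ have a $u$-$v$ rainbow cut. For a nontrivial connected graph $G$, $rd(G)$ is the smallest number of colors in an edge-coloring making $G$ rainbow disconnected. *)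

theory Defs
  imports Main
begin

type_synonym 'a ugraph = "'a set \<times> 'a set set"

abbreviation gverts :: "'a ugraph \<Rightarrow> 'a set" where
  "gverts G \<equiv> fst G"

abbreviation gedges :: "'a ugraph \<Rightarrow> 'a set set" where
  "gedges G \<equiv> snd G"

definition simple_graph :: "'a ugraph \<Rightarrow> bool" where
  "simple_graph G \<longleftrightarrow> finite (gverts G) \<and> (\<forall>e\<in>gedges G. e \<subseteq> gverts G \<and> card e = 2)"

definition gcomplement :: "'a ugraph \<Rightarrow> 'a ugraph" where
  "gcomplement G = (gverts G, {e. e \<subseteq> gverts G \<and> card e = 2 \<and> e \<notin> gedges G})"

definition delete_edges :: "'a ugraph \<Rightarrow> 'a set set \<Rightarrow> 'a ugraph" where
  "delete_edges G R = (gverts G, gedges G - R)"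

definition same_component :: "'a ugraph \<Rightarrow> 'a \<Rightarrow> 'a \<Rightarrow> bool" where
  "same_component G u v \<longleftrightarrow> (u, v) \<in> {(x, y). {x, y} \<in> gedges G}\<^sup>*"

definition gconnected :: "'a ugraph \<Rightarrow> bool" where
  "gconnected G \<longleftrightarrow> gverts G \<noteq> {} \<and> (\<forall>u\<in>gverts G. \<forall>v\<in>gverts G. same_component G u v)"

definition graph_iso :: "'a ugraph \<Rightarrow> 'b ugraph \<Rightarrow> bool" where
  "graph_iso G H \<longleftrightarrow> (\<exists>f. bij_betw f (gverts G) (gverts H) \<and>
     (\<forall>u\<in>gverts G. \<forall>v\<in>gverts G. {u, v} \<in> gedges G \<longleftrightarrow> {f u, f v} \<in> gedges H))"

definition path_graph :: "nat \<Rightarrow> nat ugraph" where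
  "path_graph n = ({0..<n}, {{i, Suc i} | i. Suc i < n})"

definition edge_cut :: "'a ugraph \<Rightarrow> 'a set set \<Rightarrow> bool" where
  "edge_cut G R \<longleftrightarrow> R \<subseteq> gedges G \<and> \<not> gconnected (delete_edges G R)"

definition rainbow_cut :: "'a ugraph \<Rightarrow> ('a set \<Rightarrow> nat) \<Rightarrow> 'a set set \<Rightarrow> bool" where
  "rainbow_cut G c R \<longleftrightarrow> edge_cut G R \<and> inj_on c R"

definition uv_rainbow_cut ::
  "'a ugraph \<Rightarrow> ('a set \<Rightarrow> nat) \<Rightarrow> 'a set set \<Rightarrow> 'a \<Rightarrow> 'a \<Rightarrow> bool" where
  "uv_rainbow_cut G c R u v \<longleftrightarrow>
     rainbow_cut G c R \<and> \<not> same_component (delete_edges G R) u v"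

definition rainbow_disconnected :: "'a ugraph \<Rightarrow> ('a set \<Rightarrow> nat) \<Rightarrow> bool" where
  "rainbow_disconnected G c \<longleftrightarrow>
     (\<forall>u\<in>gverts G. \<forall>v\<in>gverts G. u \<noteq> v \<longrightarrow> (\<exists>R. uv_rainbow_cut G c R u v))"

text \<open>Colorings are total functions, but only their values on the edges matter; any two adjacent
  edges may share a color. The minimum exists for every simple graph, since coloring all edges
  differently makes the whole edge set a rainbow cut between any two distinct vertices.\<close>

definition rd :: "'a ugraph \<Rightarrow> nat" where
  "rd G = (LEAST k. \<exists>c. c ` gedges G \<subseteq> {1..k} \<and> rainbow_disconnected G c)"

end

theory Submission
  imports Defs
begin

text \<open>A colouring with \<open>k\<close> colours is rainbow disconnecting iff any two vertices are separated by a
  vertex set whose boundary is rainbow, hence of size at most \<open>k\<close>.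

  Lower bounds: by a theorem of Mader, a graph of order \<open>n\<close> whose vertices are pairwise separated
  by at most \<open>k\<close> edges has at most \<open>(k + 1)(n - 1)/2\<close> edges. Applying this to the graph and to its
  complement, which together have \<open>n(n - 1)/2\<close> edges, bounds the sum; as both numbers are positive,
  this also bounds the product.

  Upper bounds: it suffices that the stars of all vertices but one are rainbow. Vizing's theorem, in
  the sharper form that \<open>k\<close> colours suffice if all degrees are at most \<open>k\<close> and at most two of them
  equal \<open>k\<close>, gives \<open>n - 2\<close> for graphs with connected complement, and \<open>n - 3\<close> unless two vertices have
  degree \<open>n - 2\<close>. Two such vertices are leaves of the complement, whose rainbow disconnection number
  is then at most \<open>n - 3\<close> because deleting a leaf does not matter.\<close>

text \<open>Vizing's theorem in its usual form spends one colour more than the maximum degree, and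
  the upper bounds have no room for it. The room comes from the one vertex whose star may be
  coloured arbitrarily. If \<open>w\<close> has maximum degree, deleting it lowers the degree of
  each of its many neighbours, so few vertices keep full degree, and the edges at \<open>w\<close>
  can be coloured afterwards without regard to each other. Two vertices of full degree are
  tolerable: the induction deletes one of them, and the other is the only neighbour that may have
  just one free colour. That neighbour even helps, since it makes a sum odd, which after balancing
  forces a colour offered by exactly one vertex. For the edge bound, the obstacle is that
  contracting a side of a minimum cut creates parallel edges and spoils the bound of a degree by the
  order minus one. So all of that side except one vertex \<open>u\<close> is deleted, which keeps
  the graph simple; the edges lost elsewhere are paid for by the part of the cut that misses
  \<open>u\<close>.\<close>

section \<open>Boundaries, degrees and trees in simple graphs\<close>

definition cut :: "'a set set \<Rightarrow> 'a set \<Rightarrow> 'a set set" where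
  "cut E S = {e \<in> E. e \<inter> S \<noteq> {} \<and> \<not> e \<subseteq> S}"

definition deg :: "'a set set \<Rightarrow> 'a \<Rightarrow> nat" where
  "deg E v = card {e \<in> E. v \<in> e}"

definition sgraph :: "'a set \<Rightarrow> 'a set set \<Rightarrow> bool" where
  "sgraph V E \<longleftrightarrow> finite V \<and> (\<forall>e\<in>E. e \<subseteq> V \<and> card e = 2)"

lemma sgraph_finite: "sgraph V E \<Longrightarrow> finite E"
  unfolding sgraph_def by (rule finite_subset[of _ "Pow V"]) auto

lemma sgraph_finite_verts: "sgraph V E \<Longrightarrow> finite V"
  by (simp add: sgraph_def)

lemma card2_other:
  assumes "card e = 2" "x \<in> e"
  obtains y where "e = {x, y}" "y \<noteq> x"
  using assms by (metis card_2_iff doubleton_eq_iff insertE singletonD)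

lemma edge_other:
  assumes "sgraph V E" "e \<in> E" "x \<in> e"
  obtains y where "e = {x, y}" "y \<noteq> x" "y \<in> V"
proof -
  from assms have "card e = 2" "e \<subseteq> V" by (auto simp: sgraph_def)
  with card2_other[of e x] assms(3) that show thesis by (metis insert_subset)
qed

lemma sgraph_no_loop: "sgraph V E \<Longrightarrow> {x} \<notin> E"
  by (auto simp: sgraph_def)

lemma sgraph_edge_neq: "sgraph V E \<Longrightarrow> {x, y} \<in> E \<Longrightarrow> x \<noteq> y"
  using sgraph_no_loop by fastforce

lemma sgraph_edge_verts: "sgraph V E \<Longrightarrow> {x, y} \<in> E \<Longrightarrow> x \<in> V \<and> y \<in> V"
  by (auto simp: sgraph_def)

lemma sgraph_induced: "sgraph V E \<Longrightarrow> U \<subseteq> V \<Longrightarrow> sgraph U {e \<in> E. e \<subseteq> U}"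
  by (auto simp: sgraph_def intro: finite_subset)

lemma sgraph_delete_vertex: "sgraph V E \<Longrightarrow> sgraph (V - {v}) {e \<in> E. v \<notin> e}"
  by (auto simp: sgraph_def)

lemma star_eq_image:
  assumes "sgraph V E"
  shows "{e \<in> E. x \<in> e} = (\<lambda>y. {x, y}) ` {y. {x, y} \<in> E}"
  using edge_other[OF assms] by blast

lemma deg_eq_card_neighbours:
  assumes "sgraph V E"
  shows "deg E x = card {y. {x, y} \<in> E}"
proof -
  have "inj_on (\<lambda>y. {x, y}) {y. {x, y} \<in> E}"
    by (auto simp: inj_on_def doubleton_eq_iff)
  then show ?thesis
    unfolding deg_def star_eq_image[OF assms] by (rule card_image)
qed

lemma deg_le_card_minus_1:
  assumes "sgraph V E" "x \<in> V"
  shows "deg E x \<le> card V - 1"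
proof -
  have "{y. {x, y} \<in> E} \<subseteq> V - {x}"
    using sgraph_edge_verts[OF assms(1)] sgraph_edge_neq[OF assms(1)] by blast
  then have "card {y. {x, y} \<in> E} \<le> card (V - {x})"
    using assms by (intro card_mono) (auto simp: sgraph_def)
  then show ?thesis
    using assms by (simp add: deg_eq_card_neighbours[OF assms(1)] sgraph_def)
qed

lemma sum_deg:
  assumes "sgraph V E"
  shows "(\<Sum>x\<in>V. deg E x) = 2 * card E"
proof -
  have "(\<Sum>x\<in>V. deg E x) = (\<Sum>x\<in>V. \<Sum>e\<in>{e \<in> E. x \<in> e}. 1)"
    by (simp add: deg_def)
  also have "\<dots> = (\<Sum>e\<in>E. \<Sum>x\<in>{x \<in> V. x \<in> e}. 1)"
    using assms sgraph_finite[OF assms] by (intro sum.swap_restrict) (auto simp: sgraph_def)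
  also have "\<dots> = (\<Sum>e\<in>E. 2)"
  proof (rule sum.cong)
    fix e assume e: "e \<in> E"
    then have "{x \<in> V. x \<in> e} = e" using assms by (auto simp: sgraph_def)
    then show "(\<Sum>x\<in>{x \<in> V. x \<in> e}. 1) = (2::nat)" using assms e by (simp add: sgraph_def)
  qed simp
  finally show ?thesis by simp
qed

lemma deg_delete_neighbour:
  assumes "sgraph V E" "{u, v} \<in> E"
  shows "deg E u = Suc (deg {e \<in> E. v \<notin> e} u)"
proof -
  have "{e \<in> E. u \<in> e} = insert {u, v} {e \<in> {e \<in> E. v \<notin> e}. u \<in> e}"
  proof (intro equalityI subsetI)
    fix e assume e: "e \<in> {e \<in> E. u \<in> e}"
    then obtain y where "e = {u, y}" using edge_other[OF assms(1)] by blast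
    then show "e \<in> insert {u, v} {e \<in> {e \<in> E. v \<notin> e}. u \<in> e}"
      using e sgraph_edge_neq[OF assms] by auto
  qed (use assms(2) in auto)
  then show ?thesis
    unfolding deg_def using sgraph_finite[OF assms(1)] by simp
qed

lemma deg_delete_le:
  assumes "sgraph V E"
  shows "deg {e \<in> E. P e} u \<le> deg E u"
  unfolding deg_def using sgraph_finite[OF assms] by (intro card_mono) auto

text \<open>Grow a set from \<open>r\<close> one vertex at a time along an edge of its boundary;
  each step puts a new edge inside the set. Connectedness is expressed by boundaries because this is
  what the minimality of a Kempe chain delivers.\<close>

lemma card_le_edges_of_connected:
  assumes "finite S" "r \<in> S" "finite F" "\<And>e. e \<in> F \<Longrightarrow> card e = 2 \<and> e \<subseteq> S"
    and conn: "\<And>T. T \<noteq> {} \<Longrightarrow> T \<subset> S \<Longrightarrow> cut F T \<noteq> {}"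
  shows "card S \<le> card F + 1"
proof -
  have grow: "\<exists>T\<subseteq>S. card T = Suc t \<and> Suc t \<le> card {e \<in> F. e \<subseteq> T} + 1" if "Suc t \<le> card S" for t
    using that
  proof (induction t)
    case 0
    show ?case using assms(2) by (intro exI[of _ "{r}"]) auto
  next
    case (Suc t)
    then obtain T where T: "T \<subseteq> S" "card T = Suc t" "Suc t \<le> card {e \<in> F. e \<subseteq> T} + 1"
      by auto
    then have "T \<noteq> {}" "T \<subset> S" using Suc.prems by auto
    then obtain e where e: "e \<in> F" "e \<inter> T \<noteq> {}" "\<not> e \<subseteq> T"
      using conn[of T] by (auto simp: cut_def)
    then obtain a where a: "a \<in> e" "a \<in> T" by auto
    obtain b where b: "e = {a, b}" "b \<noteq> a"
      using card2_other[of e a] a(1) assms(4)[OF e(1)] by metis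
    have bT: "b \<notin> T" using b a e by auto
    have "finite T" using T assms(1) finite_subset by auto
    have "insert e {e \<in> F. e \<subseteq> T} \<subseteq> {e \<in> F. e \<subseteq> insert b T}"
      using e b a by auto
    then have "card (insert e {e \<in> F. e \<subseteq> T}) \<le> card {e \<in> F. e \<subseteq> insert b T}"
      using assms(3) by (intro card_mono) auto
    moreover have "card (insert e {e \<in> F. e \<subseteq> T}) = Suc (card {e \<in> F. e \<subseteq> T})"
      using e assms(3) by simp
    moreover have "insert b T \<subseteq> S" using T assms(4)[OF e(1)] b by auto
    moreover have "card (insert b T) = Suc (Suc t)" using T bT \<open>finite T\<close> by simp
    ultimately show ?case using T(3) by (intro exI[of _ "insert b T"]) auto
  qed
  have "card S > 0" using assms(1,2) by (auto simp: card_gt_0_iff)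
  then obtain T where
    T: "T \<subseteq> S" "card T = card S" "card S \<le> card {e \<in> F. e \<subseteq> T} + 1"
    using grow[of "card S - 1"] by auto
  have "card {e \<in> F. e \<subseteq> T} \<le> card F" using assms(3) by (intro card_mono) auto
  then show ?thesis using T by simp
qed

section \<open>Local edge connectivity and the number of edges\<close>

lemma finite_cut: "finite E \<Longrightarrow> finite (cut E S)"
  by (simp add: cut_def)

lemma cut_Diff:
  assumes "sgraph V E"
  shows "cut E (V - S) = cut E S"
  using assms by (auto simp: cut_def sgraph_def)

text \<open>An edge in one of the two boundaries on the left lies in a boundary on the right, and an
  edge in both of them lies in both. Inclusion-exclusion turns this into the inequality.\<close>

lemma cut_submodular:
  assumes "finite E"
  shows "card (cut E (A \<inter> B)) + card (cut E (A \<union> B)) \<le> card (cut E A) + card (cut E B)"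
proof -
  note fin = finite_cut[OF assms]
  have "card (cut E (A \<inter> B)) + card (cut E (A \<union> B))
      = card (cut E (A \<inter> B) \<union> cut E (A \<union> B)) + card (cut E (A \<inter> B) \<inter> cut E (A \<union> B))"
    using fin by (intro card_Un_Int)
  also have "\<dots> \<le> card (cut E A \<union> cut E B) + card (cut E A \<inter> cut E B)"
    using fin by (intro add_mono card_mono) (auto simp: cut_def)
  also have "\<dots> = card (cut E A) + card (cut E B)"
    using fin by (intro card_Un_Int[symmetric])
  finally show ?thesis .
qed

text \<open>Submodularity for \<open>A\<close> and \<open>V - B\<close>, as a set and its complement
  have the same boundary.\<close>

lemma cut_posimodular:
  assumes "sgraph V E" "A \<subseteq> V" "B \<subseteq> V"
  shows "card (cut E (A - B)) + card (cut E (B - A)) \<le> card (cut E A) + card (cut E B)"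
proof -
  have "A \<inter> (V - B) = A - B" "V - (A \<union> (V - B)) = B - A" using assms by auto
  then show ?thesis
    using cut_submodular[OF sgraph_finite[OF assms(1)], of A "V - B"] cut_Diff[OF assms(1)]
    by metis
qed

section \<open>Minimum cuts and their uncrossing\<close>

definition min_cut :: "'a set \<Rightarrow> 'a set set \<Rightarrow> 'a \<Rightarrow> 'a \<Rightarrow> 'a set \<Rightarrow> bool" where
  "min_cut V E u v A \<longleftrightarrow> A \<subseteq> V \<and> u \<in> A \<and> v \<notin> A \<and>
     (\<forall>S. S \<subseteq> V \<and> u \<in> S \<and> v \<notin> S \<longrightarrow> card (cut E A) \<le> card (cut E S))"

lemma min_cut_le:
  "min_cut V E u v A \<Longrightarrow> S \<subseteq> V \<Longrightarrow> u \<in> S \<Longrightarrow> v \<notin> S \<Longrightarrow> card (cut E A) \<le> card (cut E S)"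
  by (simp add: min_cut_def)

lemma min_cut_mem:
  assumes "min_cut V E u v A"
  shows "A \<subseteq> V" "u \<in> A" "v \<notin> A"
  using assms by (simp_all add: min_cut_def)

lemma min_cut_exists:
  assumes "u \<in> V" "u \<noteq> v"
  obtains A where "min_cut V E u v A"
proof -
  have "{u} \<subseteq> V \<and> u \<in> {u} \<and> v \<notin> {u}" using assms by auto
  from ex_has_least_nat[of "\<lambda>A. A \<subseteq> V \<and> u \<in> A \<and> v \<notin> A", OF this, of "\<lambda>A. card (cut E A)"]
  show ?thesis using that by (auto simp: min_cut_def)
qed

lemma min_cut_complement:
  assumes "sgraph V E" "v \<in> V" "min_cut V E u v A"
  shows "min_cut V E v u (V - A)"
  unfolding min_cut_def
proof (intro conjI allI impI)
  fix S assume S: "S \<subseteq> V \<and> v \<in> S \<and> u \<notin> S"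
  have "u \<in> V" using min_cut_mem[OF assms(3)] by auto
  then have "card (cut E A) \<le> card (cut E (V - S))"
    using S by (intro min_cut_le[OF assms(3)]) auto
  then show "card (cut E (V - A)) \<le> card (cut E S)"
    by (simp add: cut_Diff[OF assms(1)])
qed (use assms(2) min_cut_mem[OF assms(3)] in auto)

text \<open>Among all minimum cuts between terminals take \<open>A\<close> with the fewest vertices.
  If it contained a second terminal \<open>w\<close>, take a minimum cut \<open>C\<close> between
  \<open>u\<close> and \<open>w\<close>, oriented so that it avoids \<open>v\<close>. Then
  \<open>A \<union> C\<close> still separates \<open>u\<close> from \<open>v\<close>, so by
  submodularity \<open>A \<inter> C\<close> is a smaller minimum cut between terminals.\<close>

lemma min_cut_isolating_terminal:
  assumes G: "sgraph V E" and "T \<subseteq> V" "x \<in> T" "y \<in> T" "x \<noteq> y"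
  obtains A u v where "min_cut V E u v A" "v \<in> T" "A \<inter> T = {u}"
proof -
  define P where "P = (\<lambda>A. \<exists>u v. u \<in> T \<and> v \<in> T \<and> min_cut V E u v A)"
  obtain A0 where "min_cut V E x y A0" using min_cut_exists assms by (metis subsetD)
  then have "P A0" using assms unfolding P_def by blast
  from ex_has_least_nat[of P, OF this, of card] obtain A
    where "P A" and least: "\<And>B. P B \<Longrightarrow> card A \<le> card B" by blast
  then obtain u v where uv: "u \<in> T" "v \<in> T" and A: "min_cut V E u v A"
    unfolding P_def by blast
  have "w = u" if w: "w \<in> A" "w \<in> T" for w
  proof (rule ccontr)
    assume "w \<noteq> u"
    then obtain C0 where C0: "min_cut V E u w C0" using min_cut_exists uv assms by (metis subsetD)
    have "\<exists>C a b. min_cut V E a b C \<and> {a, b} = {u, w} \<and> v \<notin> C"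
    proof (cases "v \<in> C0")
      case True
      have "min_cut V E w u (V - C0)"
        using min_cut_complement[OF G _ C0] w assms by blast
      then show ?thesis using True by blast
    next
      case False
      then show ?thesis using C0 by blast
    qed
    then obtain C a b where C: "min_cut V E a b C" and ab: "{a, b} = {u, w}" and v: "v \<notin> C"
      by blast
    have abA: "a \<in> A" "b \<in> A" "a \<in> T" "b \<in> T" "a \<in> C" "b \<notin> C"
      using ab w uv min_cut_mem[OF A] min_cut_mem[OF C] by (auto simp: doubleton_eq_iff)
    have "card (cut E A) \<le> card (cut E (A \<union> C))"
      using v min_cut_mem[OF A] min_cut_mem[OF C] by (intro min_cut_le[OF A]) auto
    then have le: "card (cut E (A \<inter> C)) \<le> card (cut E C)"
      using cut_submodular[OF sgraph_finite[OF G], of A C] by simp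
    have "min_cut V E a b (A \<inter> C)"
      unfolding min_cut_def
    proof (intro conjI allI impI)
      fix S assume "S \<subseteq> V \<and> a \<in> S \<and> b \<notin> S"
      then have "card (cut E C) \<le> card (cut E S)" by (intro min_cut_le[OF C]) auto
      then show "card (cut E (A \<inter> C)) \<le> card (cut E S)" using le by simp
    qed (use min_cut_mem[OF A] abA in auto)
    then have "P (A \<inter> C)" unfolding P_def using abA by blast
    then have "card A \<le> card (A \<inter> C)" by (rule least)
    moreover have "finite A" using min_cut_mem(1)[OF A] G by (auto simp: sgraph_def intro: finite_subset)
    moreover have "A \<inter> C \<subset> A" using abA by auto
    ultimately show False using psubset_card_mono[of A "A \<inter> C"] by simp
  qed
  moreover have "u \<in> A" using A by (simp add: min_cut_def)
  ultimately have "A \<inter> T = {u}" using uv by blast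
  then show ?thesis using that A uv by blast
qed

text \<open>\<open>A - C\<close> still separates \<open>u\<close> from \<open>v\<close>, so its
  boundary is at least that of \<open>A\<close>; posimodularity passes the gain to
  \<open>C - A\<close>. Hence separating sets survive when \<open>A\<close> is reduced to
  \<open>u\<close>.\<close>

lemma min_cut_uncross:
  assumes G: "sgraph V E" and A: "min_cut V E u v A" and "C \<subseteq> V" "u \<notin> C"
  shows "card (cut E (C - A)) \<le> card (cut E C)"
proof -
  have "card (cut E A) \<le> card (cut E (A - C))"
    using min_cut_mem[OF A] \<open>u \<notin> C\<close> by (intro min_cut_le[OF A]) auto
  moreover have "A \<subseteq> V" using A by (simp add: min_cut_def)
  ultimately show ?thesis
    using cut_posimodular[OF G \<open>A \<subseteq> V\<close> \<open>C \<subseteq> V\<close>] by simp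
qed

text \<open>Allowing an arbitrary set \<open>T\<close> of terminals, whose degrees may be less than \<open>k\<close>, makes
  Mader's bound amenable to induction: a minimum cut \<open>A\<close> isolating one terminal \<open>u\<close> is contracted
  to \<open>u\<close>. The edges lost at other terminals leave \<open>A\<close> at vertices other than \<open>u\<close>.\<close>

lemma sum_deg_excess_le:
  assumes "sgraph V E" "T \<subseteq> V" "T \<noteq> {}"
    and "\<And>x y. x \<in> T \<Longrightarrow> y \<in> T \<Longrightarrow> x \<noteq> y \<Longrightarrow>
      \<exists>S\<subseteq>V. x \<in> S \<and> y \<notin> S \<and> card (cut E S) \<le> k"
  shows "(\<Sum>x\<in>T. int (deg E x) - int k) \<le> int (card V) - 1 - int k"
  using assms
proof (induction "card T" arbitrary: V E T rule: less_induct)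
  case less
  note G = less.prems(1)
  have finV: "finite V" using G by (simp add: sgraph_def)
  have finE: "finite E" using sgraph_finite[OF G] .
  have finT: "finite T" using less.prems(2) finV finite_subset by auto
  show ?case
  proof (cases "\<exists>x\<in>T. \<exists>y\<in>T. x \<noteq> y")
    case False
    then obtain x where T: "T = {x}" using less.prems(3) by auto
    then have "deg E x \<le> card V - 1" "card V > 0"
      using deg_le_card_minus_1[OF G, of x] less.prems(2) finV by (auto simp: card_gt_0_iff)
    then show ?thesis using T by auto
  next
    case True
    then obtain A u v where A: "min_cut V E u v A" and v: "v \<in> T" and AT: "A \<inter> T = {u}"
      using min_cut_isolating_terminal[OF G less.prems(2)] by metis
    have AV: "A \<subseteq> V" and uA: "u \<in> A" and vA: "v \<notin> A" using min_cut_mem[OF A] by auto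
    have uT: "u \<in> T" using AT by auto
    have finA: "finite A" using AV finV finite_subset by auto
    have dA: "card (cut E A) \<le> k"
    proof -
      obtain S where "S \<subseteq> V" "u \<in> S" "v \<notin> S" "card (cut E S) \<le> k"
        using less.prems(4)[OF uT v] vA uA by auto
      then show ?thesis using min_cut_le[OF A] order_trans by blast
    qed
    define U where "U = insert u (V - A)"
    define E' where "E' = {e \<in> E. e \<subseteq> U}"
    define T' where "T' = T - {u}"
    have G': "sgraph U E'" unfolding E'_def
      using sgraph_induced[OF G] uA AV by (auto simp: U_def)
    have T'B: "T' \<subseteq> V - A" using AT less.prems(2) by (auto simp: T'_def)
    \<comment> \<open>A separating set \<open>C\<close> without \<open>u\<close> is replaced by
      \<open>C - A\<close>. If \<open>u\<close> lies in \<open>C\<close>, the same is done to the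
      complement of \<open>C\<close>, and the complement in \<open>U\<close> is taken at the
      end.\<close>
    have sep: "\<exists>S\<subseteq>U. x \<in> S \<and> y \<notin> S \<and> card (cut E' S) \<le> k"
      if xy: "x \<in> T'" "y \<in> T'" "x \<noteq> y" for x y
    proof -
      have shrink: "card (cut E' (C - A)) \<le> k" if "C \<subseteq> V" "u \<notin> C" "card (cut E C) \<le> k" for C
      proof -
        have "card (cut E' (C - A)) \<le> card (cut E (C - A))"
          using finE by (intro card_mono finite_cut) (auto simp: cut_def E'_def)
        then show ?thesis using min_cut_uncross[OF G A that(1,2)] that(3) by simp
      qed
      obtain C where C: "C \<subseteq> V" "x \<in> C" "y \<notin> C" "card (cut E C) \<le> k"
        using less.prems(4)[of x y] xy by (auto simp: T'_def)
      show ?thesis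
      proof (cases "u \<in> C")
        case False
        then show ?thesis using shrink[of C] C xy T'B
          by (intro exI[of _ "C - A"]) (auto simp: U_def)
      next
        case True
        then have "card (cut E' (V - C - A)) \<le> k"
          using shrink[of "V - C"] C by (auto simp: cut_Diff[OF G])
        then have "card (cut E' (U - (V - C - A))) \<le> k"
          by (simp add: cut_Diff[OF G'])
        then show ?thesis using C xy T'B
          by (intro exI[of _ "U - (V - C - A)"]) (auto simp: U_def)
      qed
    qed
    have "card T' < card T" using uT finT unfolding T'_def by (intro card_Diff1_less)
    moreover have "T' \<subseteq> U" "T' \<noteq> {}" using T'B v vA uA by (auto simp: U_def T'_def)
    ultimately have IH: "(\<Sum>x\<in>T'. int (deg E' x) - int k) \<le> int (card U) - 1 - int k"
      using sep by (intro less.hyps[OF _ G']) auto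
    have cardU: "int (card U) = int (card V) - int (card A) + 1"
      unfolding U_def using finV AV uA card_mono[OF finV AV] by (simp add: card_Diff_subset finA)
    \<comment> \<open>The boundary of \<open>A\<close> is split: \<open>D\<close> is charged to the
      degree of \<open>u\<close>. Each remaining edge has one end outside \<open>A\<close>, so it is
      lost by at most one terminal of \<open>T'\<close>.\<close>
    define D where "D = {e \<in> cut E A. u \<in> e}"
    have finD: "finite D" using finite_cut[OF finE] by (simp add: D_def)
    have degu: "deg E u \<le> (card A - 1) + card D"
    proof -
      have "{e \<in> E. u \<in> e} \<subseteq> {e \<in> {e \<in> E. e \<subseteq> A}. u \<in> e} \<union> D"
        using uA by (auto simp: D_def cut_def)
      then have "deg E u \<le> card ({e \<in> {e \<in> E. e \<subseteq> A}. u \<in> e} \<union> D)"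
        unfolding deg_def using finE finD by (intro card_mono) auto
      also have "\<dots> \<le> deg {e \<in> E. e \<subseteq> A} u + card D"
        unfolding deg_def by (rule card_Un_le)
      also have "deg {e \<in> E. e \<subseteq> A} u \<le> card A - 1"
        using deg_le_card_minus_1[OF sgraph_induced[OF G AV] uA] .
      finally show ?thesis by simp
    qed
    define L where "L = (\<lambda>x. {e \<in> cut E A - D. x \<in> e})"
    have degx: "deg E x \<le> deg E' x + card (L x)" if x: "x \<in> T'" for x
    proof -
      have "{e \<in> E. x \<in> e} \<subseteq> {e \<in> E'. x \<in> e} \<union> L x"
      proof
        fix e assume e: "e \<in> {e \<in> E. x \<in> e}"
        then obtain y where y: "e = {x, y}" "y \<in> V" using edge_other[OF G] by blast
        then show "e \<in> {e \<in> E'. x \<in> e} \<union> L x"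
          using e x T'B uA by (auto simp: E'_def L_def U_def cut_def D_def)
      qed
      then have "deg E x \<le> card ({e \<in> E'. x \<in> e} \<union> L x)"
        unfolding deg_def using sgraph_finite[OF G'] finite_cut[OF finE]
        by (intro card_mono) (auto simp: L_def)
      also have "\<dots> \<le> deg E' x + card (L x)" unfolding deg_def by (rule card_Un_le)
      finally show ?thesis .
    qed
    have "(\<Sum>x\<in>T'. card (L x)) = card (\<Union>x\<in>T'. L x)"
    proof (rule card_UN_disjoint[symmetric])
      show "finite T'" using finT by (simp add: T'_def)
      show "\<forall>x\<in>T'. finite (L x)" using finite_cut[OF finE] by (simp add: L_def)
      show "\<forall>x\<in>T'. \<forall>y\<in>T'. x \<noteq> y \<longrightarrow> L x \<inter> L y = {}"
      proof (intro ballI impI, rule ccontr)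
        fix x y assume xy: "x \<in> T'" "y \<in> T'" "x \<noteq> y" and "L x \<inter> L y \<noteq> {}"
        then obtain e where e: "e \<in> cut E A" "x \<in> e" "y \<in> e" by (auto simp: L_def)
        have "e \<in> E" using e(1) by (simp add: cut_def)
        then obtain z where "e = {x, z}" using edge_other[OF G _ e(2)] by blast
        then have "e = {x, y}" using e xy by auto
        then show False using e xy T'B by (auto simp: cut_def)
      qed
    qed
    also have "\<dots> \<le> card (cut E A - D)"
      using finite_cut[OF finE] by (intro card_mono) (auto simp: L_def)
    also have "\<dots> = card (cut E A) - card D"
      using finD by (intro card_Diff_subset) (auto simp: D_def)
    finally have sumL: "(\<Sum>x\<in>T'. card (L x)) \<le> card (cut E A) - card D" .
    have DA: "card D \<le> card (cut E A)"
      using finite_cut[OF finE] by (intro card_mono) (auto simp: D_def)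
    \<comment> \<open>The balance: \<open>u\<close> contributes at most
      \<open>card A - 1 + card D - k\<close>, the other terminals lose at most
      \<open>k - card D\<close> edges, and the order drops by \<open>card A - 1\<close>. These add
      up to exactly the claimed bound.\<close>
    have "(\<Sum>x\<in>T. int (deg E x) - int k)
        = (int (deg E u) - int k) + (\<Sum>x\<in>T'. int (deg E x) - int k)"
      unfolding T'_def using finT uT by (simp add: sum.remove)
    also have "(\<Sum>x\<in>T'. int (deg E x) - int k)
        \<le> (\<Sum>x\<in>T'. (int (deg E' x) - int k) + int (card (L x)))"
      using degx by (intro sum_mono) force
    also have "\<dots> = (\<Sum>x\<in>T'. int (deg E' x) - int k) + int (\<Sum>x\<in>T'. card (L x))"
      by (simp add: sum.distrib)
    finally have "(\<Sum>x\<in>T. int (deg E x) - int k) \<le> int (deg E u) - int k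
        + (\<Sum>x\<in>T'. int (deg E' x) - int k) + int (\<Sum>x\<in>T'. card (L x))" by simp
    moreover have "card A \<ge> 1" using uA finA by (auto simp: Suc_le_eq card_gt_0_iff)
    ultimately show ?thesis
      using IH cardU degu sumL DA dA by linarith
  qed
qed

section \<open>Edge colourings\<close>

definition proper_colouring :: "'a set set \<Rightarrow> ('a set \<Rightarrow> nat) \<Rightarrow> bool" where
  "proper_colouring E c \<longleftrightarrow> (\<forall>e\<in>E. \<forall>f\<in>E. e \<noteq> f \<longrightarrow> e \<inter> f \<noteq> {} \<longrightarrow> c e \<noteq> c f)"

text \<open>A colour class is a matching that avoids the vertices missing the colour, so its ends
  and \<open>X\<close> are disjoint parts of \<open>S\<close>.\<close>

lemma card_colour_class_missing:
  assumes "finite S" "X \<subseteq> S" and F: "\<And>e. e \<in> F \<Longrightarrow> card e = 2 \<and> e \<subseteq> S \<and> e \<inter> X = {}"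
    and disj: "\<And>e f. e \<in> F \<Longrightarrow> f \<in> F \<Longrightarrow> e \<noteq> f \<Longrightarrow> e \<inter> f = {}"
  shows "2 * card F + card X \<le> card S"
proof -
  have "card (\<Union>F) = (\<Sum>e\<in>F. card e)"
    using F disj assms(1) by (intro card_Union_disjoint) (auto simp: pairwise_def disjnt_def intro: finite_subset)
  also have "\<dots> = 2 * card F" using F by simp
  finally have "2 * card F = card (\<Union>F)" by simp
  also have "\<dots> \<le> card (S - X)" using F assms(1) by (intro card_mono) auto
  also have "\<dots> = card S - card X" using assms(1,2) by (intro card_Diff_subset) (auto intro: finite_subset)
  finally show ?thesis using card_mono[OF assms(1,2)] by simp
qed

section \<open>Kempe chains and balanced missing colours\<close>

text \<open>\<open>M u\<close> holds some colours that are free at \<open>u\<close>, not necessarily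
  all of them, so that its size can be prescribed.\<close>

definition admissible ::
    "'a set set \<Rightarrow> nat set \<Rightarrow> 'a set \<Rightarrow> ('a set \<Rightarrow> nat) \<Rightarrow> ('a \<Rightarrow> nat set) \<Rightarrow> bool" where
  "admissible E K N c M \<longleftrightarrow> proper_colouring E c \<and> c ` E \<subseteq> K \<and>
     (\<forall>u\<in>N. M u \<subseteq> K \<and> (\<forall>e\<in>E. u \<in> e \<longrightarrow> c e \<notin> M u))"

text \<open>A set closed under the edges of colours \<open>i\<close> and \<open>j\<close> is a union of Kempe chains. A
  minimal one with more vertices missing \<open>i\<close> than vertices missing \<open>j\<close> is a single chain, so by
  counting edges it has at most two ends.\<close>

lemma kempe_chain_exists:
  assumes "finite E" "\<And>e. e \<in> E \<Longrightarrow> card e = 2" "finite N" "admissible E K N c M" "i \<noteq> j"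
    and gt: "card {u \<in> N. i \<in> M u} > card {u \<in> N. j \<in> M u}"
  obtains S where "\<And>e. e \<in> E \<Longrightarrow> c e \<in> {i, j} \<Longrightarrow> e \<inter> S \<noteq> {} \<Longrightarrow> e \<subseteq> S"
    "card ({u \<in> N. j \<in> M u} \<inter> S) < card ({u \<in> N. i \<in> M u} \<inter> S)"
    "card ({u \<in> N. i \<in> M u} \<inter> S) \<le> 2"
proof -
  define V where "V = \<Union>E \<union> N"
  define F where "F = {e \<in> E. c e \<in> {i, j}}"
  define Xi where "Xi = {u \<in> N. i \<in> M u}"
  define Xj where "Xj = {u \<in> N. j \<in> M u}"
  define P where "P = (\<lambda>S. S \<subseteq> V \<and> (\<forall>e\<in>F. e \<inter> S \<noteq> {} \<longrightarrow> e \<subseteq> S) \<and> card (Xj \<inter> S) < card (Xi \<inter> S))"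
  have "finite e" if "e \<in> E" for e using assms(2)[OF that] by (intro card_ge_0_finite) simp
  then have finV: "finite V" unfolding V_def using assms(1,3) by auto
  have fX: "finite Xi" "finite Xj" using assms(3) by (auto simp: Xi_def Xj_def)
  have "Xi \<inter> V = Xi" "Xj \<inter> V = Xj" by (auto simp: Xi_def Xj_def V_def)
  then have "P V" unfolding P_def using gt by (auto simp: F_def V_def Xi_def Xj_def)
  from ex_has_least_nat[of P, OF this, of card] obtain S
    where S: "P S" and least: "\<And>T. P T \<Longrightarrow> card S \<le> card T" by blast
  have SV: "S \<subseteq> V" and finS: "finite S" using S finV finite_subset by (auto simp: P_def)
  have closed: "e \<subseteq> S" if "e \<in> F" "e \<inter> S \<noteq> {}" for e using S that by (auto simp: P_def)
  define FS where "FS = {e \<in> F. e \<subseteq> S}"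
  have finFS: "finite FS" using assms(1) by (simp add: FS_def F_def)
  \<comment> \<open>If no edge of \<open>F\<close> left \<open>T\<close>, both \<open>T\<close> and
    \<open>S - T\<close> would be closed, and one of them would keep the excess of \<open>i\<close>
    over \<open>j\<close>, against the minimality of \<open>S\<close>.\<close>
  have conn: "cut FS T \<noteq> {}" if T: "T \<noteq> {}" "T \<subset> S" for T
  proof
    assume "cut FS T = {}"
    have T1: "e \<subseteq> T" if e: "e \<in> F" "e \<inter> T \<noteq> {}" for e
    proof -
      have "e \<subseteq> S" using closed[OF e(1)] e(2) T(2) by blast
      then show ?thesis using e \<open>cut FS T = {}\<close> unfolding cut_def FS_def by blast
    qed
    have T2: "e \<subseteq> S - T" if e: "e \<in> F" "e \<inter> (S - T) \<noteq> {}" for e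
    proof -
      have "e \<subseteq> S" using closed[OF e(1)] e(2) by blast
      moreover have "e \<inter> T = {}" using T1[OF e(1)] e(2) by blast
      ultimately show ?thesis by blast
    qed
    have split: "card (X \<inter> S) = card (X \<inter> T) + card (X \<inter> (S - T))" if "finite X" for X
    proof -
      have "X \<inter> S = (X \<inter> T) \<union> (X \<inter> (S - T))" using T by auto
      then show ?thesis using that by (simp add: card_Un_disjoint Int_Diff_disjoint disjoint_iff)
    qed
    have "card (Xj \<inter> S) < card (Xi \<inter> S)" using S by (simp add: P_def)
    then have "card (Xj \<inter> T) < card (Xi \<inter> T) \<or> card (Xj \<inter> (S - T)) < card (Xi \<inter> (S - T))"
      using split[OF fX(1)] split[OF fX(2)] by linarith
    then have "P T \<or> P (S - T)" unfolding P_def using T1 T2 T SV by blast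
    moreover have "card T < card S" "card (S - T) < card S"
      using T finS by (auto intro!: psubset_card_mono)
    ultimately show False using least by (meson not_le)
  qed
  have "card (Xi \<inter> S) > 0" using S by (simp add: P_def)
  then obtain r where "r \<in> S" by (metis Int_iff card.empty ex_in_conv less_numeral_extra(3))
  then have tree: "card S \<le> card FS + 1"
    using finS finFS conn assms(2)
    by (intro card_le_edges_of_connected) (auto simp: FS_def F_def)
  have colour: "2 * card {e \<in> FS. c e = l} + card ({u \<in> N. l \<in> M u} \<inter> S) \<le> card S" for l
    using finS assms(2,4)
    by (intro card_colour_class_missing)
       (auto simp: FS_def F_def admissible_def proper_colouring_def)
  have "FS = {e \<in> FS. c e = i} \<union> {e \<in> FS. c e = j}" by (auto simp: FS_def F_def)
  then have "card FS = card {e \<in> FS. c e = i} + card {e \<in> FS. c e = j}"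
    using card_Un_disjoint[of "{e \<in> FS. c e = i}" "{e \<in> FS. c e = j}"] finFS assms(5) by auto
  \<comment> \<open>Adding the two colour counts gives \<open>2 * card FS + card (Xi \<inter> S) +
    card (Xj \<inter> S) \<le> 2 * card S\<close>, and the right side is at most
    \<open>2 * card FS + 2\<close>.\<close>
  then have "card (Xi \<inter> S) \<le> 2"
    using tree colour[of i] colour[of j] by (simp add: Xi_def)
  moreover have "card (Xj \<inter> S) < card (Xi \<inter> S)" using S by (simp add: P_def)
  ultimately show ?thesis
    using that[of S] closed by (auto simp: F_def Xi_def Xj_def)
qed

definition swap_colours :: "nat \<Rightarrow> nat \<Rightarrow> nat \<Rightarrow> nat" where
  "swap_colours i j = id(i := j, j := i)"

lemma swap_colours_simps [simp]:
  "swap_colours i j i = j" "swap_colours i j j = i"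
  "l \<noteq> i \<Longrightarrow> l \<noteq> j \<Longrightarrow> swap_colours i j l = l"
  by (auto simp: swap_colours_def)

lemma swap_colours_eq_iff [simp]: "swap_colours i j a = swap_colours i j b \<longleftrightarrow> a = b"
  by (auto simp: swap_colours_def)

lemma swap_colours_mem: "i \<in> K \<Longrightarrow> j \<in> K \<Longrightarrow> l \<in> K \<Longrightarrow> swap_colours i j l \<in> K"
  by (auto simp: swap_colours_def)

lemma swap_colours_image_iff: "l \<in> swap_colours i j ` A \<longleftrightarrow> swap_colours i j l \<in> A"
  by (auto simp: swap_colours_def image_iff split: if_splits)

text \<open>An edge that meets \<open>S\<close> and has an end outside \<open>S\<close> is not
  coloured \<open>i\<close> or \<open>j\<close>, so the swap does not change it. Thus at every
  vertex the colours of its edges and its set \<open>M u\<close> undergo the same permutation: the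
  swap inside \<open>S\<close>, the identity outside.\<close>

lemma kempe_swap_admissible:
  assumes adm: "admissible E K N c M" and ij: "i \<in> K" "j \<in> K"
    and closed: "\<And>e. e \<in> E \<Longrightarrow> c e \<in> {i, j} \<Longrightarrow> e \<inter> S \<noteq> {} \<Longrightarrow> e \<subseteq> S"
  shows "admissible E K N (\<lambda>e. if e \<inter> S \<noteq> {} then swap_colours i j (c e) else c e)
    (\<lambda>u. if u \<in> S then swap_colours i j ` M u else M u)"
    (is "admissible E K N ?c ?M")
proof -
  have outside: "?c e = c e" if "e \<in> E" "x \<in> e" "x \<notin> S" for e x
  proof (cases "e \<inter> S \<noteq> {}")
    case True
    then have "c e \<notin> {i, j}" using closed[of e] that by auto
    then show ?thesis by auto
  qed auto
  have inside: "?c e = swap_colours i j (c e)" if "x \<in> e" "x \<in> S" for e x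
    using that by auto
  show ?thesis
    unfolding admissible_def proper_colouring_def
  proof (intro conjI ballI impI)
    fix e f assume ef: "e \<in> E" "f \<in> E" "e \<noteq> f" "e \<inter> f \<noteq> {}"
    then obtain x where x: "x \<in> e" "x \<in> f" by auto
    have "c e \<noteq> c f" using adm ef by (auto simp: admissible_def proper_colouring_def)
    then show "?c e \<noteq> ?c f"
      using inside[OF x(1)] inside[OF x(2)] outside[OF ef(1) x(1)] outside[OF ef(2) x(2)]
      by (cases "x \<in> S") simp_all
  next
    show "?c ` E \<subseteq> K" using adm ij by (auto simp: admissible_def intro!: swap_colours_mem)
  next
    fix u assume "u \<in> N"
    then show "?M u \<subseteq> K" using adm ij by (auto simp: admissible_def intro!: swap_colours_mem)
  next
    fix u e assume ue: "u \<in> N" "e \<in> E" "u \<in> e"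
    then have "c e \<notin> M u" using adm by (auto simp: admissible_def)
    then show "?c e \<notin> ?M u"
      using inside[OF ue(3)] outside[OF ue(2,3)] by (cases "u \<in> S") auto
  qed
qed

text \<open>Moving \<open>d = p - q\<close> units from \<open>a\<close> to \<open>b\<close> changes
  the sum of squares by \<open>2 * d * (d - (a - b))\<close>, which is negative since
  \<open>d\<close> is at most 2 and the gap at least 3. This is where the threshold 3 comes
  from.\<close>

lemma square_sum_shift:
  fixes a b p q :: nat
  assumes "a \<ge> b + 3" "q < p" "p \<le> 2" "p \<le> a" "q \<le> b"
  shows "(a - p + q)\<^sup>2 + (b - q + p)\<^sup>2 < a\<^sup>2 + b\<^sup>2"
proof -
  define d where "d = p - q"
  have d: "d = 1 \<or> d = 2" using assms by (auto simp: d_def)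
  have "a - p + q = a - d" "b - q + p = b + d" using assms by (auto simp: d_def)
  moreover obtain t where "a = b + 3 + t" using assms(1) le_Suc_ex by blast
  ultimately show ?thesis using d by (auto simp: power2_eq_square algebra_simps)
qed

text \<open>Swapping on a chain with an excess of \<open>i\<close> moves one or two units from the
  count of \<open>i\<close> to that of \<open>j\<close>. The sum of squares serves as the potential
  of the balancing.\<close>

lemma kempe_balance_step:
  assumes "finite E" "\<And>e. e \<in> E \<Longrightarrow> card e = 2" "finite N" "finite K"
    and adm: "admissible E K N c M" and ij: "i \<in> K" "j \<in> K"
    and gt: "card {u \<in> N. i \<in> M u} \<ge> card {u \<in> N. j \<in> M u} + 3"
  shows "\<exists>c' M'. admissible E K N c' M' \<and> (\<forall>u. card (M' u) = card (M u)) \<and>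
    (\<Sum>l\<in>K. (card {u \<in> N. l \<in> M' u})\<^sup>2) < (\<Sum>l\<in>K. (card {u \<in> N. l \<in> M u})\<^sup>2)"
proof -
  have neq: "i \<noteq> j" using gt by auto
  obtain S where closed: "\<And>e. e \<in> E \<Longrightarrow> c e \<in> {i, j} \<Longrightarrow> e \<inter> S \<noteq> {} \<Longrightarrow> e \<subseteq> S"
    and lt: "card ({u \<in> N. j \<in> M u} \<inter> S) < card ({u \<in> N. i \<in> M u} \<inter> S)"
    and le2: "card ({u \<in> N. i \<in> M u} \<inter> S) \<le> 2"
    using kempe_chain_exists[OF assms(1,2,3) adm neq] gt by auto
  define c' where "c' = (\<lambda>e. if e \<inter> S \<noteq> {} then swap_colours i j (c e) else c e)"
  define M' where "M' = (\<lambda>u. if u \<in> S then swap_colours i j ` M u else M u)"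
  define X where "X = (\<lambda>l. {u \<in> N. l \<in> M u})"
  define X' where "X' = (\<lambda>l. {u \<in> N. l \<in> M' u})"
  have finX: "finite (X l)" for l using assms(3) by (simp add: X_def)
  have adm': "admissible E K N c' M'"
    unfolding c'_def M'_def using kempe_swap_admissible[OF adm ij closed] .
  have cardM: "card (M' u) = card (M u)" for u
    unfolding M'_def by (auto intro!: card_image simp: inj_on_def)
  have X': "X' l = (X l - S) \<union> (X (swap_colours i j l) \<inter> S)" for l
    by (auto simp: X'_def X_def M'_def swap_colours_image_iff)
  have cardX': "card (X' l) = card (X l) - card (X l \<inter> S) + card (X (swap_colours i j l) \<inter> S)" for l
  proof -
    have "card (X' l) = card (X l - S) + card (X (swap_colours i j l) \<inter> S)"
      unfolding X' using finX by (intro card_Un_disjoint) auto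
    then show ?thesis using finX by (simp add: card_Diff_subset_Int)
  qed
  have other: "card (X' l) = card (X l)" if "l \<noteq> i" "l \<noteq> j" for l
    unfolding cardX' using that card_mono[OF finX, of "X l \<inter> S" l] by simp
  have sumK: "(\<Sum>l\<in>K. g l) = g i + g j + (\<Sum>l\<in>K - {i, j}. g l)" for g :: "nat \<Rightarrow> nat"
  proof -
    have "(\<Sum>l\<in>K. g l) = g i + (\<Sum>l\<in>K - {i}. g l)" using assms(4) ij by (simp add: sum.remove)
    also have "(\<Sum>l\<in>K - {i}. g l) = g j + (\<Sum>l\<in>K - {i} - {j}. g l)"
      using assms(4) ij neq by (intro sum.remove) auto
    also have "K - {i} - {j} = K - {i, j}" by auto
    finally show ?thesis by simp
  qed
  have "(card (X' i))\<^sup>2 + (card (X' j))\<^sup>2 < (card (X i))\<^sup>2 + (card (X j))\<^sup>2"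
    unfolding cardX' swap_colours_simps
  proof (rule square_sum_shift)
    show "card (X j) + 3 \<le> card (X i)" using gt by (simp add: X_def)
    show "card (X j \<inter> S) < card (X i \<inter> S)" "card (X i \<inter> S) \<le> 2" using lt le2 by (simp_all add: X_def)
    show "card (X i \<inter> S) \<le> card (X i)" "card (X j \<inter> S) \<le> card (X j)"
      by (intro card_mono[OF finX] Int_lower1)+
  qed
  moreover have "(\<Sum>l\<in>K - {i, j}. (card (X' l))\<^sup>2) = (\<Sum>l\<in>K - {i, j}. (card (X l))\<^sup>2)"
    using other by (intro sum.cong) auto
  ultimately have "(\<Sum>l\<in>K. (card (X' l))\<^sup>2) < (\<Sum>l\<in>K. (card (X l))\<^sup>2)"
    by (subst (1 2) sumK) simp
  then show ?thesis using adm' cardM unfolding X_def X'_def by blast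
qed

text \<open>The average is below 2, so some value is 0 or 1. If 1 never occurs, then 0 does, balance
  caps every value at 2, and all values are even.\<close>

lemma odd_sum_balanced_has_one:
  fixes f :: "nat \<Rightarrow> nat"
  assumes "finite K" "(\<Sum>l\<in>K. f l) < 2 * card K" "odd (\<Sum>l\<in>K. f l)"
    and "\<And>i j. i \<in> K \<Longrightarrow> j \<in> K \<Longrightarrow> f i \<le> f j + 2"
  obtains i where "i \<in> K" "f i = 1"
proof (rule ccontr)
  assume "\<not> thesis"
  then have ne1: "\<And>i. i \<in> K \<Longrightarrow> f i \<noteq> 1" using that by blast
  have "\<exists>j\<in>K. f j < 2"
  proof (rule ccontr)
    assume "\<not> ?thesis"
    then have "(\<Sum>l\<in>K. 2) \<le> (\<Sum>l\<in>K. f l)" by (intro sum_mono) (auto simp: not_less)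
    then show False using assms(2) by simp
  qed
  then obtain j where j: "j \<in> K" "f j = 0" using ne1 by (metis One_nat_def less_2_cases)
  have "even (f i)" if "i \<in> K" for i
  proof -
    have "f i \<le> 2" "f i \<noteq> 1" using assms(4)[OF that j(1)] j ne1[OF that] by auto
    then have "f i = 0 \<or> f i = 2" by linarith
    then show ?thesis by auto
  qed
  then have "even (\<Sum>l\<in>K. f l)" by (rule dvd_sum)
  then show False using assms(3) by simp
qed

text \<open>Schrijver's proof of Vizing's theorem. The sets \<open>M u\<close> contain colours missing at \<open>u\<close>. If the
  numbers of vertices missing each colour are balanced by Kempe swaps, then some colour \<open>i\<close> is
  missing at exactly one vertex; assign \<open>i\<close> to it, remove the colour class of \<open>i\<close> and recurse.\<close>

lemma colouring_with_distinct_missing: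
  assumes "finite E" "\<And>e. e \<in> E \<Longrightarrow> card e = 2" "finite N" "finite K" "card N \<le> card K"
    and "admissible E K N c M"
    and "\<And>u. u \<in> N \<Longrightarrow> u \<noteq> u0 \<Longrightarrow> card (M u) \<ge> 2" "u0 \<in> N \<Longrightarrow> card (M u0) \<ge> 1"
  shows "\<exists>c' f. proper_colouring E c' \<and> c' ` E \<subseteq> K \<and> inj_on f N \<and> f ` N \<subseteq> K \<and>
    (\<forall>u\<in>N. \<forall>e\<in>E. u \<in> e \<longrightarrow> c' e \<noteq> f u)"
  using assms
proof (induction "card N" arbitrary: E N K c M u0)
  case 0
  then have "N = {}" by simp
  then show ?case using 0 by (intro exI[of _ c]) (auto simp: admissible_def)
next
  case (Suc n)
  have finE: "finite E" and E2: "\<And>e. e \<in> E \<Longrightarrow> card e = 2" and finN: "finite N"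
    and finK: "finite K" and NK: "card N \<le> card K" using Suc.prems by auto
  obtain u1 where u1: "u1 \<in> N" "\<And>u. u \<in> N \<Longrightarrow> u \<noteq> u1 \<Longrightarrow> card (M u) \<ge> 2" "card (M u1) \<ge> 1"
  proof (cases "u0 \<in> N")
    case True
    then show ?thesis using that[of u0] Suc.prems by auto
  next
    case False
    obtain u where "u \<in> N" using Suc.hyps(2) by (metis card.empty ex_in_conv nat.distinct(1))
    moreover have "v \<noteq> u0" if "v \<in> N" for v using False that by auto
    ultimately show ?thesis using that[of u] Suc.prems(7) by (metis one_le_numeral order_trans)
  qed
  \<comment> \<open>Prescribing size 1 at \<open>u1\<close> and 2 elsewhere makes the total
    \<open>2 * card N - 1\<close>, which is odd and less than \<open>2 * card K\<close>.\<close>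
  define m where "m = (\<lambda>u. if u = u1 then 1 else 2 :: nat)"
  have "\<forall>u. \<exists>A. u \<in> N \<longrightarrow> A \<subseteq> M u \<and> card A = m u"
  proof
    fix u
    have "\<exists>A\<subseteq>M u. card A = m u" if "u \<in> N"
    proof -
      have "m u \<le> card (M u)" using u1 that by (auto simp: m_def)
      then show ?thesis by (metis obtain_subset_with_card_n)
    qed
    then show "\<exists>A. u \<in> N \<longrightarrow> A \<subseteq> M u \<and> card A = m u" by blast
  qed
  then obtain M0 where M0: "\<And>u. u \<in> N \<Longrightarrow> M0 u \<subseteq> M u \<and> card (M0 u) = m u" by metis
  define Q where "Q = (\<lambda>(c, M). admissible E K N c M \<and> (\<forall>u\<in>N. card (M u) = m u))"
  have "Q (c, M0)" using Suc.prems(6) M0 unfolding Q_def admissible_def by blast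
  from ex_has_least_nat[of Q, OF this,
      of "\<lambda>(c, M). \<Sum>l\<in>K. (card {u \<in> N. l \<in> M u})\<^sup>2"]
  obtain c1 M1 where adm: "admissible E K N c1 M1" and cM: "\<And>u. u \<in> N \<Longrightarrow> card (M1 u) = m u"
    and least: "\<And>c' M'. Q (c', M') \<Longrightarrow>
      (\<Sum>l\<in>K. (card {u \<in> N. l \<in> M1 u})\<^sup>2) \<le> (\<Sum>l\<in>K. (card {u \<in> N. l \<in> M' u})\<^sup>2)"
    unfolding Q_def by auto
  define X where "X = (\<lambda>l. {u \<in> N. l \<in> M1 u})"
  have balanced: "card (X i) \<le> card (X j) + 2" if ij: "i \<in> K" "j \<in> K" for i j
  proof (rule ccontr)
    assume "\<not> ?thesis"
    then have gt: "card {u \<in> N. i \<in> M1 u} \<ge> card {u \<in> N. j \<in> M1 u} + 3" by (simp add: X_def)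
    obtain c' M'
      where "admissible E K N c' M'" "\<forall>u. card (M' u) = card (M1 u)"
        "(\<Sum>l\<in>K. (card {u \<in> N. l \<in> M' u})\<^sup>2) < (\<Sum>l\<in>K. (card {u \<in> N. l \<in> M1 u})\<^sup>2)"
      using kempe_balance_step[OF finE E2 finN finK adm ij gt] by blast
    moreover from this have "Q (c', M')" using cM by (simp add: Q_def)
    ultimately show False using least[of c' M'] by simp
  qed
  have M1K: "M1 u \<subseteq> K" if "u \<in> N" for u using adm that by (auto simp: admissible_def)
  have "(\<Sum>l\<in>K. card (X l)) = (\<Sum>l\<in>K. \<Sum>u\<in>{u \<in> N. l \<in> M1 u}. 1)"
    by (simp add: X_def)
  also have "\<dots> = (\<Sum>u\<in>N. \<Sum>l\<in>{l \<in> K. l \<in> M1 u}. 1)"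
    using finK finN by (intro sum.swap_restrict)
  also have "\<dots> = (\<Sum>u\<in>N. m u)"
  proof (rule sum.cong)
    fix u assume "u \<in> N"
    then have "{l \<in> K. l \<in> M1 u} = M1 u" using M1K by auto
    then show "(\<Sum>l\<in>{l \<in> K. l \<in> M1 u}. 1) = m u" using cM[OF \<open>u \<in> N\<close>] by simp
  qed simp
  also have "\<dots> = m u1 + (\<Sum>u\<in>N - {u1}. m u)" using finN u1 by (simp add: sum.remove)
  also have "\<dots> = 1 + 2 * (card N - 1)" using finN u1 by (simp add: m_def)
  finally have sumX: "(\<Sum>l\<in>K. card (X l)) = 2 * n + 1" using Suc.hyps(2) by simp
  obtain i where i: "i \<in> K" "card (X i) = 1"
    using odd_sum_balanced_has_one[OF finK, of "\<lambda>l. card (X l)"] balanced sumX NK Suc.hyps(2)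
    by auto
  then obtain u where u: "X i = {u}" by (meson card_1_singletonE)
  then have uN: "u \<in> N" and iu: "i \<in> M1 u" by (auto simp: X_def)
  have only: "i \<notin> M1 w" if "w \<in> N" "w \<noteq> u" for w using u that by (auto simp: X_def)
  define E' where "E' = {e \<in> E. c1 e \<noteq> i}"
  have adm': "admissible E' (K - {i}) (N - {u}) c1 M1"
    unfolding admissible_def
  proof (intro conjI ballI)
    show "proper_colouring E' c1"
      using adm by (simp add: admissible_def proper_colouring_def E'_def)
    show "c1 ` E' \<subseteq> K - {i}" using adm by (auto simp: admissible_def E'_def)
    fix w assume w: "w \<in> N - {u}"
    then show "M1 w \<subseteq> K - {i}" using M1K[of w] only[of w] by blast
    fix e assume "e \<in> E'"
    then show "w \<in> e \<longrightarrow> c1 e \<notin> M1 w" using adm w by (simp add: admissible_def E'_def)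
  qed
  have "\<exists>c' f. proper_colouring E' c' \<and> c' ` E' \<subseteq> K - {i} \<and> inj_on f (N - {u}) \<and>
      f ` (N - {u}) \<subseteq> K - {i} \<and> (\<forall>w\<in>N - {u}. \<forall>e\<in>E'. w \<in> e \<longrightarrow> c' e \<noteq> f w)"
  \<comment> \<open>\<open>u1\<close> remains the exceptional vertex. If it is the removed vertex
    \<open>u\<close>, its condition becomes vacuous.\<close>
  proof (rule Suc.hyps(1)[of "N - {u}" E' "K - {i}" c1 M1 u1])
    show "n = card (N - {u})" using Suc.hyps(2) finN uN by simp
    show "card (N - {u}) \<le> card (K - {i})" using NK finN finK uN i by simp
    show "finite E'" "finite (N - {u})" "finite (K - {i})"
      using finE finN finK by (simp_all add: E'_def)
    show "card e = 2" if "e \<in> E'" for e using E2 that by (simp add: E'_def)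
    show "2 \<le> card (M1 w)" if "w \<in> N - {u}" "w \<noteq> u1" for w
      using cM[of w] that by (simp add: m_def)
    show "1 \<le> card (M1 u1)" if "u1 \<in> N - {u}"
      using cM[of u1] that by (simp add: m_def)
  qed (fact adm')
  then obtain c2 f where c2: "proper_colouring E' c2" "c2 ` E' \<subseteq> K - {i}" "inj_on f (N - {u})"
      "f ` (N - {u}) \<subseteq> K - {i}" "\<forall>w\<in>N - {u}. \<forall>e\<in>E'. w \<in> e \<longrightarrow> c2 e \<noteq> f w"
    by (elim exE conjE) (rule that)
  define c3 where "c3 = (\<lambda>e. if c1 e = i then i else c2 e)"
  define g where "g = f(u := i)"
  have c2i: "c2 e \<noteq> i" "c2 e \<in> K" if "e \<in> E" "c1 e \<noteq> i" for e using c2(2) that by (auto simp: E'_def)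
  have fi: "f w \<noteq> i" "f w \<in> K" if "w \<in> N" "w \<noteq> u" for w using c2(4) that by auto
  have "proper_colouring E c3"
    unfolding proper_colouring_def
  proof (intro ballI impI)
    fix e e' assume ee: "e \<in> E" "e' \<in> E" "e \<noteq> e'" "e \<inter> e' \<noteq> {}"
    then have "c1 e \<noteq> c1 e'" using adm by (auto simp: admissible_def proper_colouring_def)
    moreover have "c2 e \<noteq> c2 e'" if "c1 e \<noteq> i" "c1 e' \<noteq> i"
      using c2(1) ee that by (auto simp: E'_def proper_colouring_def)
    ultimately show "c3 e \<noteq> c3 e'" using c2i ee unfolding c3_def by metis
  qed
  moreover have "c3 ` E \<subseteq> K" using c2i i by (auto simp: c3_def)
  moreover have "inj_on g N"
  proof (rule inj_onI)
    fix x y assume "x \<in> N" "y \<in> N" "g x = g y"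
    then show "x = y" using c2(3) fi[of x] fi[of y] unfolding g_def inj_on_def
      by (metis DiffI fun_upd_apply singletonD)
  qed
  moreover have "g ` N \<subseteq> K" using fi i by (auto simp: g_def)
  moreover have "c3 e \<noteq> g w" if "w \<in> N" "e \<in> E" "w \<in> e" for w e
  proof (cases "w = u")
    case True
    have "c1 e \<noteq> i" using adm that True iu by (auto simp: admissible_def)
    then show ?thesis using c2i that True by (simp add: c3_def g_def)
  next
    case False
    then show ?thesis using that c2(5) fi[of w] by (auto simp: c3_def g_def E'_def)
  qed
  ultimately show ?case by blast
qed

text \<open>Delete \<open>v\<close>, chosen of degree \<open>k\<close> if possible, and colour the
  rest. A neighbour \<open>u\<close> of \<open>v\<close> has at least \<open>k + 1 - deg E u\<close>
  free colours, as its edge to \<open>v\<close> is still uncoloured. This is at least 2, except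
  perhaps 1 at the other vertex of degree \<open>k\<close>. After recolouring, distinct free colours
  at the neighbours serve the edges at \<open>v\<close>.\<close>

lemma degree_bound_colouring:
  assumes "sgraph V E" "\<And>v. v \<in> V \<Longrightarrow> deg E v \<le> k" "card {v \<in> V. deg E v = k} \<le> 2"
  shows "\<exists>c. proper_colouring E c \<and> c ` E \<subseteq> {1..k}"
  using assms
proof (induction "card V" arbitrary: V E)
  case 0
  then have "V = {}" by (simp add: sgraph_def)
  then have "E = {}" using 0(2) by (fastforce simp: sgraph_def)
  then show ?case by (simp add: proper_colouring_def)
next
  case (Suc n)
  note G = Suc.prems(1)
  have finV: "finite V" and finE: "finite E" using G sgraph_finite[OF G] by (auto simp: sgraph_def)
  define H where "H = {v \<in> V. deg E v = k}"
  have finH: "finite H" and H2: "card H \<le> 2" using finV Suc.prems(3) by (auto simp: H_def)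
  obtain v where v: "v \<in> V" "card (H - {v}) \<le> 1"
  proof (cases "H = {}")
    case True
    obtain v where "v \<in> V" using Suc.hyps(2) by (metis card.empty ex_in_conv nat.distinct(1))
    then show ?thesis using that[of v] True by simp
  next
    case False
    then obtain v where "v \<in> H" by auto
    then show ?thesis using that[of v] finH H2 by (auto simp: H_def)
  qed
  define E' where "E' = {e \<in> E. v \<notin> e}"
  have G': "sgraph (V - {v}) E'" unfolding E'_def by (rule sgraph_delete_vertex[OF G])
  have degE': "deg E' u \<le> deg E u" for u unfolding E'_def by (rule deg_delete_le[OF G])
  have "{u \<in> V - {v}. deg E' u = k} \<subseteq> H"
  proof
    fix u assume "u \<in> {u \<in> V - {v}. deg E' u = k}"
    then show "u \<in> H" using degE'[of u] Suc.prems(2)[of u] by (simp add: H_def)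
  qed
  then have "card {u \<in> V - {v}. deg E' u = k} \<le> 2"
    using card_mono[OF finH] H2 order_trans by blast
  moreover have "deg E' u \<le> k" if "u \<in> V - {v}" for u
    using degE'[of u] Suc.prems(2)[of u] that by auto
  moreover have "n = card (V - {v})" using Suc.hyps(2) finV v by simp
  ultimately obtain c where c: "proper_colouring E' c" "c ` E' \<subseteq> {1..k}"
    using Suc.hyps(1)[OF _ G'] by blast
  define N where "N = {u. {v, u} \<in> E}"
  have NV: "N \<subseteq> V - {v}" using sgraph_edge_verts[OF G] sgraph_edge_neq[OF G] by (auto simp: N_def)
  have finN: "finite N" using NV finV finite_subset by blast
  define M where "M = (\<lambda>u. {1..k} - c ` {e \<in> E'. u \<in> e})"
  have cardM: "card (M u) \<ge> Suc k - deg E u" if "u \<in> N" for u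
  proof -
    have "{u, v} \<in> E" using that by (simp add: N_def insert_commute)
    then have "deg E u = Suc (deg E' u)" unfolding E'_def by (rule deg_delete_neighbour[OF G])
    moreover have "card (c ` {e \<in> E'. u \<in> e}) \<le> deg E' u"
      unfolding deg_def using sgraph_finite[OF G'] by (intro card_image_le) auto
    moreover have "card (M u) \<ge> card {1..k} - card (c ` {e \<in> E'. u \<in> e})"
      unfolding M_def using sgraph_finite[OF G'] by (intro diff_card_le_card_Diff) auto
    ultimately show ?thesis by simp
  qed
  obtain u0 where u0: "H - {v} \<subseteq> {u0}"
  proof (cases "H - {v} = {}")
    case True
    then show ?thesis using that by blast
  next
    case False
    then have "card (H - {v}) = 1" using v(2) finH by (simp add: card_gt_0_iff le_antisym Suc_le_eq)
    then show ?thesis using that by (metis card_1_singletonE order_refl)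
  qed
  have "card N \<le> card {1..k}"
    using Suc.prems(2)[OF v(1)] by (simp add: deg_eq_card_neighbours[OF G] N_def)
  moreover have "admissible E' {1..k} N c M"
    using c by (auto simp: admissible_def M_def)
  moreover have "card (M u) \<ge> 2" if "u \<in> N" "u \<noteq> u0" for u
  proof -
    have "deg E u < k" using that u0 NV Suc.prems(2)[of u] by (auto simp: H_def le_less)
    then show ?thesis using cardM[OF that(1)] by simp
  qed
  moreover have "card (M u0) \<ge> 1" if "u0 \<in> N"
    using cardM[OF that] Suc.prems(2)[of u0] that NV by fastforce
  ultimately obtain c' f where c': "proper_colouring E' c'" "c' ` E' \<subseteq> {1..k}" "inj_on f N"
      "f ` N \<subseteq> {1..k}" and miss: "\<forall>u\<in>N. \<forall>e\<in>E'. u \<in> e \<longrightarrow> c' e \<noteq> f u"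
    using colouring_with_distinct_missing[of E' N "{1..k}" c M u0] G' sgraph_finite[OF G'] finN
    by (auto simp: sgraph_def)
  define d where "d = (\<lambda>e. if v \<in> e then f (the_elem (e - {v})) else c' e)"
  have star: "\<exists>u\<in>N. e = {v, u} \<and> d e = f u" if e: "e \<in> E" "v \<in> e" for e
  proof -
    obtain u where u: "e = {v, u}" "u \<noteq> v" using edge_other[OF G e] by metis
    then have "e - {v} = {u}" by auto
    then show ?thesis using u e by (auto simp: d_def N_def)
  qed
  have mixed: "d e \<noteq> d e'" if ee: "e \<in> E" "e' \<in> E" "v \<in> e" "v \<notin> e'" "e \<inter> e' \<noteq> {}" for e e'
  proof -
    obtain u where u: "u \<in> N" "e = {v, u}" "d e = f u" using star[OF ee(1,3)] by blast
    then have "u \<in> e'" using ee by auto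
    then have "c' e' \<noteq> f u" using miss u ee by (auto simp: E'_def)
    then show ?thesis using u ee by (simp add: d_def)
  qed
  have "proper_colouring E d"
    unfolding proper_colouring_def
  proof (intro ballI impI)
    fix e e' assume ee: "e \<in> E" "e' \<in> E" "e \<noteq> e'" "e \<inter> e' \<noteq> {}"
    consider "v \<in> e" "v \<in> e'" | "v \<in> e" "v \<notin> e'" | "v \<notin> e" "v \<in> e'" | "v \<notin> e" "v \<notin> e'" by blast
    then show "d e \<noteq> d e'"
    proof cases
      case 1
      then obtain u u' where "u \<in> N" "e = {v, u}" "d e = f u" "u' \<in> N" "e' = {v, u'}" "d e' = f u'"
        using star ee by metis
      then show ?thesis using c'(3) ee by (auto simp: inj_on_def)
    next
      case 2
      then show ?thesis using mixed ee by blast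
    next
      case 3
      then show ?thesis using mixed[of e' e] ee by (metis Int_commute)
    next
      case 4
      then show ?thesis using c'(1) ee by (auto simp: proper_colouring_def d_def E'_def)
    qed
  qed
  moreover have "d e \<in> {1..k}" if "e \<in> E" for e
  proof (cases "v \<in> e")
    case True
    then show ?thesis using star[OF that True] c'(4) by auto
  next
    case False
    then show ?thesis using c'(2) that by (auto simp: d_def E'_def)
  qed
  ultimately show ?case by blast
qed

section \<open>Rainbow disconnection\<close>

lemma simple_graph_iff_sgraph: "simple_graph (V, E) \<longleftrightarrow> sgraph V E"
  by (simp add: simple_graph_def sgraph_def)

lemma same_component_edge: "{x, y} \<in> E \<Longrightarrow> same_component (V, E) x y"
  by (auto simp: same_component_def)

lemma same_component_trans:
  "same_component G x y \<Longrightarrow> same_component G y z \<Longrightarrow> same_component G x z"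
  by (auto simp: same_component_def)

lemma same_component_sym:
  assumes "same_component G x y"
  shows "same_component G y x"
proof -
  have "sym {(x, y). {x, y} \<in> gedges G}" by (auto simp: sym_def insert_commute)
  then show ?thesis using assms sym_rtrancl unfolding same_component_def by (metis symD)
qed

lemma same_component_closed:
  assumes "same_component (V, E) x y" "x \<in> S" "cut E S = {}"
  shows "y \<in> S"
  using assms(1) unfolding same_component_def
proof (induction rule: rtrancl_induct)
  case base
  show ?case by (fact assms(2))
next
  case (step y z)
  then show ?case using assms(3) by (auto simp: cut_def)
qed

lemma gconnected_imp_cut_nonempty:
  assumes "gconnected (V, E)" "T \<noteq> {}" "T \<subset> V"
  shows "cut E T \<noteq> {}"
proof
  assume "cut E T = {}"
  moreover obtain x y where xy: "x \<in> T" "y \<in> V - T" using assms by blast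
  moreover have "same_component (V, E) x y" using assms xy by (auto simp: gconnected_def)
  ultimately show False using same_component_closed by fastforce
qed

lemma gconnected_rootI:
  assumes "r \<in> V" "\<And>v. v \<in> V \<Longrightarrow> same_component (V, E) r v"
  shows "gconnected (V, E)"
proof -
  have "same_component (V, E) u v" if "u \<in> V" "v \<in> V" for u v
    using same_component_trans[OF same_component_sym[OF assms(2)[OF that(1)]] assms(2)[OF that(2)]] .
  then show ?thesis using assms(1) by (auto simp: gconnected_def)
qed

text \<open>A rainbow cut \<open>R\<close> contains the boundary of the component of
  \<open>u\<close> left by its removal; conversely, a rainbow boundary is itself a rainbow
  cut.\<close>

lemma rainbow_disconnected_iff_cuts:
  assumes G: "sgraph V E"
  shows "rainbow_disconnected (V, E) c \<longleftrightarrow>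
    (\<forall>u\<in>V. \<forall>v\<in>V. u \<noteq> v \<longrightarrow> (\<exists>S\<subseteq>V. u \<in> S \<and> v \<notin> S \<and> inj_on c (cut E S)))"
proof -
  have "(\<exists>R. uv_rainbow_cut (V, E) c R u v) \<longleftrightarrow> (\<exists>S\<subseteq>V. u \<in> S \<and> v \<notin> S \<and> inj_on c (cut E S))"
    if uv: "u \<in> V" "v \<in> V" for u v
  proof
    assume "\<exists>R. uv_rainbow_cut (V, E) c R u v"
    then obtain R where R: "R \<subseteq> E" "inj_on c R" "\<not> same_component (V, E - R) u v"
      by (auto simp: uv_rainbow_cut_def rainbow_cut_def edge_cut_def delete_edges_def)
    define S where "S = {x \<in> V. same_component (V, E - R) u x}"
    have "cut E S \<subseteq> R"
    proof (rule subsetI, rule ccontr)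
      fix e assume e: "e \<in> cut E S" "e \<notin> R"
      then obtain a where a: "a \<in> e" "a \<in> S" and eE: "e \<in> E" by (auto simp: cut_def)
      then obtain b where b: "e = {a, b}" "b \<in> V" using edge_other[OF G eE a(1)] by metis
      have "same_component (V, E - R) a b" using b e eE by (intro same_component_edge) auto
      then have "b \<in> S" using a b same_component_trans by (fastforce simp: S_def)
      then show False using a b e by (auto simp: cut_def)
    qed
    then have "inj_on c (cut E S)" using R inj_on_subset by blast
    moreover have "u \<in> S" "v \<notin> S" using uv R by (auto simp: S_def same_component_def)
    ultimately show "\<exists>S\<subseteq>V. u \<in> S \<and> v \<notin> S \<and> inj_on c (cut E S)"
      by (intro exI[of _ S]) (auto simp: S_def)
  next
    assume "\<exists>S\<subseteq>V. u \<in> S \<and> v \<notin> S \<and> inj_on c (cut E S)"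
    then obtain S where S: "u \<in> S" "v \<notin> S" "inj_on c (cut E S)" by auto
    have "cut (E - cut E S) S = {}" by (auto simp: cut_def)
    then have "\<not> same_component (V, E - cut E S) u v"
      using same_component_closed S by metis
    then have "uv_rainbow_cut (V, E) c (cut E S) u v"
      using uv S unfolding uv_rainbow_cut_def rainbow_cut_def edge_cut_def delete_edges_def gconnected_def
      by (auto simp: cut_def)
    then show "\<exists>R. uv_rainbow_cut (V, E) c R u v" by blast
  qed
  then show ?thesis unfolding rainbow_disconnected_def by auto
qed

lemma rd_le:
  "c ` E \<subseteq> {1..k} \<Longrightarrow> rainbow_disconnected (V, E) c \<Longrightarrow> rd (V, E) \<le> k"
  unfolding rd_def by (rule Least_le) auto

lemma cut_singleton:
  assumes "sgraph V E"
  shows "cut E {u} = {e \<in> E. u \<in> e}"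
  using sgraph_no_loop[OF assms] assms by (fastforce simp: cut_def sgraph_def subset_singleton_iff)

text \<open>Of two distinct vertices one differs from \<open>w\<close>, and its star is the boundary
  of its singleton and of the complement of that.\<close>

lemma rainbow_disconnected_stars:
  assumes G: "sgraph V E" and star: "\<And>u. u \<in> V \<Longrightarrow> u \<noteq> w \<Longrightarrow> inj_on c {e \<in> E. u \<in> e}"
  shows "rainbow_disconnected (V, E) c"
  unfolding rainbow_disconnected_iff_cuts[OF G]
proof (intro ballI impI)
  fix u v assume uv: "u \<in> V" "v \<in> V" "u \<noteq> v"
  show "\<exists>S\<subseteq>V. u \<in> S \<and> v \<notin> S \<and> inj_on c (cut E S)"
  proof (cases "u = w")
    case False
    then show ?thesis using uv star[of u] by (intro exI[of _ "{u}"]) (simp add: cut_singleton[OF G])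
  next
    case True
    then show ?thesis using uv star[of v]
      by (intro exI[of _ "V - {v}"]) (auto simp: cut_Diff[OF G] cut_singleton[OF G])
  qed
qed

lemma rd_attained:
  assumes G: "sgraph V E"
  obtains c where "c ` E \<subseteq> {1..rd (V, E)}" "rainbow_disconnected (V, E) c"
proof -
  obtain h where h: "bij_betw h E {0..<card E}"
    using ex_bij_betw_finite_nat[OF sgraph_finite[OF G]] by blast
  have "h e < card E" if "e \<in> E" for e using bij_betw_apply[OF h that] by simp
  then have "(Suc \<circ> h) ` E \<subseteq> {1..card E}" by (auto simp: Suc_le_eq)
  moreover have inj: "inj_on (Suc \<circ> h) E" using bij_betw_imp_inj_on[OF h] by (auto simp: inj_on_def)
  have "rainbow_disconnected (V, E) (Suc \<circ> h)"
    using G by (rule rainbow_disconnected_stars) (rule inj_on_subset[OF inj], auto)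
  ultimately have "\<exists>k c. c ` gedges (V, E) \<subseteq> {1..k} \<and> rainbow_disconnected (V, E) c"
    by (metis snd_conv)
  from LeastI_ex[OF this] show ?thesis using that unfolding rd_def by auto
qed

text \<open>A rainbow boundary has no more edges than there are colours. Both lower bounds on
  \<open>rd\<close> below use the colouring only in this way.\<close>

lemma small_cut_exists:
  assumes G: "sgraph V E" and "u \<in> V" "v \<in> V" "u \<noteq> v"
  obtains S where "S \<subseteq> V" "u \<in> S" "v \<notin> S" "card (cut E S) \<le> rd (V, E)"
proof -
  obtain c where c: "c ` E \<subseteq> {1..rd (V, E)}" "rainbow_disconnected (V, E) c"
    using rd_attained[OF G] .
  obtain S where S: "S \<subseteq> V" "u \<in> S" "v \<notin> S" "inj_on c (cut E S)"
    using rainbow_disconnected_iff_cuts[OF G, THEN iffD1, OF c(2), rule_format, OF assms(2-4)]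
    by (elim exE conjE)
  have "c ` cut E S \<subseteq> {1..rd (V, E)}" using c(1) by (auto simp: cut_def)
  then have "card (c ` cut E S) \<le> card {1..rd (V, E)}" by (intro card_mono) auto
  then have "card (cut E S) \<le> rd (V, E)" using S(4) by (simp add: card_image)
  then show ?thesis using that S by blast
qed

text \<open>Taking all vertices as terminals and \<open>k\<close> for \<open>rd (V, E)\<close>, the
  excess bound reads \<open>2 * card E - card V * k \<le> card V - 1 - k\<close>.\<close>

lemma card_edges_le_rd:
  assumes G: "sgraph V E" and "V \<noteq> {}"
  shows "2 * card E \<le> (rd (V, E) + 1) * (card V - 1)"
proof -
  have "(\<Sum>x\<in>V. int (deg E x) - int (rd (V, E))) \<le> int (card V) - 1 - int (rd (V, E))"
  proof (rule sum_deg_excess_le[OF G order_refl assms(2)])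
    fix x y assume "x \<in> V" "y \<in> V" "x \<noteq> y"
    from small_cut_exists[OF G this] show "\<exists>S\<subseteq>V. x \<in> S \<and> y \<notin> S \<and> card (cut E S) \<le> rd (V, E)"
      by metis
  qed
  moreover have "(\<Sum>x\<in>V. int (deg E x) - int (rd (V, E)))
      = int (\<Sum>x\<in>V. deg E x) - int (card V) * int (rd (V, E))"
    by (simp add: sum_subtractf)
  moreover have "(\<Sum>x\<in>V. deg E x) = 2 * card E" by (rule sum_deg[OF G])
  moreover have "card V \<ge> 1"
    using assms sgraph_finite_verts[OF G] by (simp add: Suc_le_eq card_gt_0_iff)
  ultimately have "int (2 * card E) \<le> (int (rd (V, E)) + 1) * (int (card V) - 1)"
    by (simp add: algebra_simps)
  also have "\<dots> = int ((rd (V, E) + 1) * (card V - 1))"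
    using \<open>card V \<ge> 1\<close> by (simp add: of_nat_diff) (simp add: algebra_simps)
  finally show ?thesis by (simp only: of_nat_le_iff)
qed

text \<open>A set separating \<open>x\<close> from \<open>y\<close> cuts the edge between them and,
  for each common neighbour, one of its two edges to \<open>x\<close> and \<open>y\<close>.\<close>

lemma card_common_neighbours_less_rd:
  assumes G: "sgraph V E" and xy: "{x, y} \<in> E" and M: "\<And>m. m \<in> M \<Longrightarrow> {x, m} \<in> E \<and> {y, m} \<in> E"
  shows "card M < rd (V, E)"
proof -
  have "x \<in> V" "y \<in> V" "x \<noteq> y"
    using sgraph_edge_verts[OF G xy] sgraph_edge_neq[OF G xy] by auto
  then obtain S where S: "x \<in> S" "y \<notin> S" "card (cut E S) \<le> rd (V, E)"
    using small_cut_exists[OF G] by metis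
  have Mneq: "m \<noteq> x \<and> m \<noteq> y" if "m \<in> M" for m
    using sgraph_edge_neq[OF G] M[OF that] by blast
  have "M \<subseteq> V" using M sgraph_edge_verts[OF G] by blast
  then have finM: "finite M" using sgraph_finite_verts[OF G] finite_subset by blast
  define h where "h = (\<lambda>m. if m \<in> S then {y, m} else {x, m})"
  have "inj_on h M" using Mneq by (auto simp: inj_on_def h_def doubleton_eq_iff)
  moreover have "{x, y} \<notin> h ` M" using Mneq by (auto simp: h_def doubleton_eq_iff)
  ultimately have "card (insert {x, y} (h ` M)) = Suc (card M)"
    using finM by (simp add: card_image)
  moreover have "insert {x, y} (h ` M) \<subseteq> cut E S"
    using S M xy by (auto simp: h_def cut_def)
  ultimately have "Suc (card M) \<le> card (cut E S)"
    using card_mono[OF finite_cut[OF sgraph_finite[OF G]]] by metis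
  then show ?thesis using S by simp
qed

text \<open>Colour the graph without a vertex \<open>w\<close> of maximum degree properly and extend the colouring
  so that all stars other than the one at \<open>w\<close> are rainbow. Vertices of degree \<open>k\<close> in the remaining
  graph are not adjacent to \<open>w\<close>, so there are at most two of them.\<close>

lemma rd_le_of_degrees:
  assumes G: "sgraph V E" and "x \<in> V" "\<And>v. v \<in> V \<Longrightarrow> v \<noteq> x \<Longrightarrow> deg E v \<le> k" "card V \<le> k + 3"
  shows "rd (V, E) \<le> k"
proof -
  have finV: "finite V" using sgraph_finite_verts[OF G] .
  have "Max (deg E ` V) \<in> deg E ` V" using finV assms(2) by (intro Max_in) auto
  then obtain w where w: "w \<in> V" "Max (deg E ` V) = deg E w" by auto
  have max: "deg E v \<le> deg E w" if "v \<in> V" for v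
    using Max_ge[of "deg E ` V" "deg E v"] finV that w(2) by simp
  \<comment> \<open>Only \<open>x\<close> can have degree above \<open>k\<close>. If
    \<open>x\<close> is not \<open>w\<close>, maximality of \<open>w\<close> bounds its degree too,
    so \<open>w\<close> takes over as the exceptional vertex.\<close>
  have degk: "deg E v \<le> k" if "v \<in> V" "v \<noteq> w" for v
  proof (cases "v = x")
    case True
    then have "deg E v \<le> deg E w" "deg E w \<le> k" using that max assms(3) w by auto
    then show ?thesis by simp
  next
    case False
    then show ?thesis using that assms(3) by simp
  qed
  define E' where "E' = {e \<in> E. w \<notin> e}"
  have G': "sgraph (V - {w}) E'" unfolding E'_def by (rule sgraph_delete_vertex[OF G])
  have degE': "deg E' u \<le> deg E u" for u unfolding E'_def by (rule deg_delete_le[OF G])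
  have nbr: "deg E' u < k" if "{u, w} \<in> E" for u
  proof -
    have "deg E u = Suc (deg E' u)" unfolding E'_def by (rule deg_delete_neighbour[OF G that])
    moreover have "deg E u \<le> k"
      using sgraph_edge_verts[OF G that] sgraph_edge_neq[OF G that] by (intro degk) auto
    ultimately show ?thesis by simp
  qed
  have "card {v \<in> V - {w}. deg E' v = k} \<le> 2"
  proof (cases "deg E w < k")
    case True
    have "deg E' v \<noteq> k" if "v \<in> V" for v using True max[OF that] degE'[of v] by simp
    then have "{v \<in> V - {w}. deg E' v = k} = {}" by auto
    then show ?thesis by (simp only: card.empty zero_le)
  next
    case False
    have sub: "{y. {w, y} \<in> E} \<subseteq> V - {w}"
      using sgraph_edge_verts[OF G] sgraph_edge_neq[OF G] by blast
    have "{v \<in> V - {w}. deg E' v = k} \<subseteq> (V - {w}) - {y. {w, y} \<in> E}"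
      using nbr by (auto simp: insert_commute)
    then have "card {v \<in> V - {w}. deg E' v = k} \<le> card ((V - {w}) - {y. {w, y} \<in> E})"
      using finV by (intro card_mono) auto
    also have "\<dots> = card (V - {w}) - deg E w"
      unfolding deg_eq_card_neighbours[OF G] using sub finV
      by (intro card_Diff_subset) (auto intro: finite_subset)
    \<comment> \<open>The order hypothesis is made for this: at most \<open>card V - 1 - k\<close>
      vertices besides \<open>w\<close> are not adjacent to it.\<close>
    also have "\<dots> \<le> 2" using False assms(4) w(1) finV by simp
    finally show ?thesis .
  qed
  moreover have "deg E' v \<le> k" if "v \<in> V - {w}" for v
    using degE'[of v] degk[of v] that by auto
  ultimately obtain c where c: "proper_colouring E' c" "c ` E' \<subseteq> {1..k}"
    using degree_bound_colouring[OF G'] by blast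
  \<comment> \<open>Each edge at \<open>w\<close> needs only a colour free at its other end;
    repetitions at \<open>w\<close> are harmless because its star need not be rainbow.\<close>
  have "\<exists>i. {u, w} \<in> E \<longrightarrow> i \<in> {1..k} - c ` {e \<in> E'. u \<in> e}" for u
  proof (cases "{u, w} \<in> E")
    case True
    have "finite {e \<in> E'. u \<in> e}" using sgraph_finite[OF G'] by simp
    then have "card (c ` {e \<in> E'. u \<in> e}) < card {1..k}"
      using card_image_le[of "{e \<in> E'. u \<in> e}" c] nbr[OF True] by (simp add: deg_def)
    then have "\<not> {1..k} \<subseteq> c ` {e \<in> E'. u \<in> e}"
      using card_mono[of "c ` {e \<in> E'. u \<in> e}" "{1..k}"] \<open>finite {e \<in> E'. u \<in> e}\<close> by auto
    then show ?thesis by blast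
  qed simp
  then obtain g where g: "\<And>u. {u, w} \<in> E \<Longrightarrow> g u \<in> {1..k} - c ` {e \<in> E'. u \<in> e}" by metis
  define d where "d = (\<lambda>e. if w \<in> e then g (the_elem (e - {w})) else c e)"
  have dw: "d {u, w} = g u" if "u \<noteq> w" for u
  proof -
    have "{u, w} - {w} = {u}" using that by auto
    then show ?thesis by (simp add: d_def)
  qed
  have "d e \<in> {1..k}" if e: "e \<in> E" for e
  proof (cases "w \<in> e")
    case True
    then obtain u where "e = {w, u}" "u \<noteq> w" using edge_other[OF G e] by metis
    then have "e = {u, w}" "u \<noteq> w" by auto
    then show ?thesis using dw g e by auto
  next
    case False
    then show ?thesis using c(2) e by (auto simp: d_def E'_def)
  qed
  then have "d ` E \<subseteq> {1..k}" by blast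
  moreover have "inj_on d {e \<in> E. u \<in> e}" if u: "u \<in> V" "u \<noteq> w" for u
  proof -
    have new: "d {u, w} \<noteq> d e" if "{u, w} \<in> E" "e \<in> E" "u \<in> e" "w \<notin> e" for e
      using g[OF that(1)] that dw[OF u(2)] by (auto simp: d_def E'_def)
    have only: "e = {u, w}" if "e \<in> E" "u \<in> e" "w \<in> e" for e
    proof -
      obtain y where "e = {u, y}" using edge_other[OF G \<open>e \<in> E\<close> \<open>u \<in> e\<close>] by metis
      then show ?thesis using that u by auto
    qed
    show ?thesis
    proof (rule inj_onI, rule ccontr)
      fix e f assume ef: "e \<in> {e \<in> E. u \<in> e}" "f \<in> {e \<in> E. u \<in> e}" "d e = d f" "e \<noteq> f"
      then have ef': "e \<in> E" "u \<in> e" "f \<in> E" "u \<in> f" by auto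
      consider "w \<in> e" "w \<in> f" | "w \<in> e" "w \<notin> f" | "w \<notin> e" "w \<in> f" | "w \<notin> e" "w \<notin> f" by blast
      then show False
      proof cases
        case 1
        then show ?thesis using only[OF ef'(1,2)] only[OF ef'(3,4)] ef(4) by simp
      next
        case 2
        then show ?thesis using only[OF ef'(1,2)] new[OF _ ef'(3,4)] ef(3) ef'(1) by simp
      next
        case 3
        then show ?thesis using only[OF ef'(3,4)] new[OF _ ef'(1,2)] ef(3) ef'(3) by simp
      next
        case 4
        then have "d e = c e" "d f = c f" "e \<in> E'" "f \<in> E'" "e \<inter> f \<noteq> {}"
          using ef' by (auto simp: d_def E'_def)
        then show ?thesis using c(1) ef(3,4) unfolding proper_colouring_def by metis
      qed
    qed
  qed
  ultimately show ?thesis using rd_le rainbow_disconnected_stars[OF G] by metis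
qed

lemma deg_le_1_unique:
  assumes "sgraph V E" "deg E z \<le> 1" "{z, x} \<in> E" "{z, y} \<in> E"
  shows "x = y"
proof -
  have "{y. {z, y} \<in> E} \<subseteq> V" using sgraph_edge_verts[OF assms(1)] by blast
  then have "finite {y. {z, y} \<in> E}" using sgraph_finite_verts[OF assms(1)] finite_subset by blast
  then show ?thesis
    using assms(2-4) unfolding deg_eq_card_neighbours[OF assms(1)] One_nat_def
    by (simp add: card_le_Suc0_iff_eq)
qed

text \<open>The vertex \<open>z\<close> is separated from all others by its star of at most one
  edge. For other pairs, put \<open>z\<close> on the side of its neighbour, so that the edge at
  \<open>z\<close> is not cut. That edge gets colour 1, hence \<open>k \<ge> 1\<close>.\<close>

lemma rd_delete_pendant:
  assumes G: "sgraph V E" and "z \<in> V" "deg E z \<le> 1" "k \<ge> 1"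
    and le: "rd (V - {z}, {e \<in> E. z \<notin> e}) \<le> k"
  shows "rd (V, E) \<le> k"
proof -
  define E' where "E' = {e \<in> E. z \<notin> e}"
  have G': "sgraph (V - {z}) E'" unfolding E'_def by (rule sgraph_delete_vertex[OF G])
  obtain c where c: "c ` E' \<subseteq> {1..rd (V - {z}, E')}" and rdc: "rainbow_disconnected (V - {z}, E') c"
    using rd_attained[OF G'] .
  define d where "d = (\<lambda>e. if z \<in> e then 1 else c e)"
  have "d ` E \<subseteq> {1..k}"
    using c le \<open>k \<ge> 1\<close> unfolding E'_def[symmetric] by (fastforce simp: d_def E'_def)
  moreover have "rainbow_disconnected (V, E) d"
    unfolding rainbow_disconnected_iff_cuts[OF G]
  proof (intro ballI impI)
    fix u v assume uv: "u \<in> V" "v \<in> V" "u \<noteq> v"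
    have inj_z: "inj_on d (cut E {z})"
    proof (rule inj_onI)
      fix e f assume "e \<in> cut E {z}" "f \<in> cut E {z}"
      then have "e \<in> E" "z \<in> e" "f \<in> E" "z \<in> f" by (auto simp: cut_singleton[OF G])
      moreover from this obtain a b where "e = {z, a}" "f = {z, b}" using edge_other[OF G] by metis
      ultimately show "e = f" using deg_le_1_unique[OF G assms(3), of a b] by simp
    qed
    consider "u = z" | "v = z" | "u \<noteq> z" "v \<noteq> z" by blast
    then show "\<exists>S\<subseteq>V. u \<in> S \<and> v \<notin> S \<and> inj_on d (cut E S)"
    proof cases
      case 1
      then show ?thesis using uv inj_z by (intro exI[of _ "{z}"]) auto
    next
      case 2
      then show ?thesis using uv inj_z by (intro exI[of _ "V - {z}"]) (auto simp: cut_Diff[OF G])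
    next
      case 3
      have uv': "u \<in> V - {z}" "v \<in> V - {z}" using uv 3 by auto
      obtain S where S: "S \<subseteq> V - {z}" "u \<in> S" "v \<notin> S" "inj_on c (cut E' S)"
        using rainbow_disconnected_iff_cuts[OF G', THEN iffD1, OF rdc, rule_format, OF uv' uv(3)]
        by (elim exE conjE)
      define S' where "S' = S \<union> {a. a = z \<and> (\<exists>s\<in>S. {z, s} \<in> E)}"
      have sub: "cut E S' \<subseteq> cut E' S"
      proof
        fix e assume e: "e \<in> cut E S'"
        then have eE: "e \<in> E" "e \<inter> S' \<noteq> {}" "\<not> e \<subseteq> S'" by (auto simp: cut_def)
        have "z \<notin> e"
        proof
          assume "z \<in> e"
          then obtain y where y: "e = {z, y}" "y \<noteq> z" using edge_other[OF G eE(1)] by metis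
          show False
          proof (cases "y \<in> S")
            case True
            then show ?thesis using y eE by (auto simp: S'_def)
          next
            case False
            then have "z \<in> S'" using y eE by (auto simp: S'_def)
            then obtain s where "s \<in> S" "{z, s} \<in> E" using S by (auto simp: S'_def)
            then show ?thesis
              using False deg_le_1_unique[OF G assms(3), of s y] y eE by auto
          qed
        qed
        then show "e \<in> cut E' S" using eE by (auto simp: cut_def E'_def S'_def)
      qed
      have "inj_on d (cut E S')"
      proof (rule inj_onI)
        fix e f assume "e \<in> cut E S'" "f \<in> cut E S'" "d e = d f"
        moreover from this have "e \<in> cut E' S" "f \<in> cut E' S" using sub by auto
        moreover from this have "z \<notin> e" "z \<notin> f" by (auto simp: cut_def E'_def)
        ultimately show "e = f" using S(4) by (auto simp: d_def inj_on_def)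
      qed
      then show ?thesis using S 3 uv \<open>z \<in> V\<close>
        by (intro exI[of _ S']) (auto simp: S'_def)
    qed
  qed
  ultimately show ?thesis by (rule rd_le)
qed

text \<open>Without \<open>z\<close> there are \<open>card V - 1\<close> vertices, and each one that
  is neither \<open>w\<close> nor adjacent to \<open>w\<close> misses both itself and
  \<open>w\<close>, so its degree is at most \<open>card V - 3\<close>. The neighbour of
  \<open>w\<close> is the exceptional vertex of the degree bound.\<close>

lemma rd_le_two_leaves:
  assumes G: "sgraph V E" and zw: "z \<in> V" "w \<in> V" "z \<noteq> w"
    and leaf: "deg E z \<le> 1" "deg E w \<le> 1" and n: "card V \<ge> 4"
  shows "rd (V, E) \<le> card V - 3"
proof (rule rd_delete_pendant[OF G zw(1) leaf(1)])
  define E' where "E' = {e \<in> E. z \<notin> e}"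
  have G': "sgraph (V - {z}) E'" unfolding E'_def by (rule sgraph_delete_vertex[OF G])
  have finV: "finite V" using sgraph_finite_verts[OF G] .
  obtain x where x: "x \<in> V - {z}" "\<And>y. y \<in> V - {z} \<Longrightarrow> {w, y} \<in> E \<Longrightarrow> y = x"
  proof (cases "\<exists>y\<in>V - {z}. {w, y} \<in> E")
    case True
    then show ?thesis using that deg_le_1_unique[OF G leaf(2)] by blast
  next
    case False
    \<comment> \<open>Without a neighbour of \<open>w\<close> other than \<open>z\<close>, any
      vertex would do as \<open>x\<close>.\<close>
    then show ?thesis using that[of w] zw by blast
  qed
  have "rd (V - {z}, E') \<le> card V - 3"
  proof (rule rd_le_of_degrees[OF G' x(1)])
    fix v assume v: "v \<in> V - {z}" "v \<noteq> x"
    show "deg E' v \<le> card V - 3"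
    proof (cases "v = w")
      case True
      have "deg E' w \<le> deg E w" unfolding E'_def by (rule deg_delete_le[OF G])
      then show ?thesis using True leaf n by simp
    next
      case False
      have "{w, v} \<notin> E" using x(2) v by blast
      then have "{y. {v, y} \<in> E'} \<subseteq> V - {z, v, w}"
        using sgraph_edge_verts[OF G'] sgraph_edge_neq[OF G'] by (auto simp: E'_def insert_commute)
      then have "deg E' v \<le> card (V - {z, v, w})"
        unfolding deg_eq_card_neighbours[OF G'] using finV by (intro card_mono) auto
      also have "\<dots> = card V - 3"
        using False v zw finV by (subst card_Diff_subset) auto
      finally show ?thesis .
    qed
  qed (use n zw finV in auto)
  then show "rd (V - {z}, {e \<in> E. z \<notin> e}) \<le> card V - 3" by (simp add: E'_def)
qed (use n in auto)

section \<open>Graphs and their complements\<close>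

definition cedges :: "'a set \<Rightarrow> 'a set set \<Rightarrow> 'a set set" where
  "cedges V E = {e. e \<subseteq> V \<and> card e = 2 \<and> e \<notin> E}"

lemma gcomplement_eq: "gcomplement (V, E) = (V, cedges V E)"
  by (simp add: gcomplement_def cedges_def)

lemma sgraph_cedges: "sgraph V E \<Longrightarrow> sgraph V (cedges V E)"
  by (auto simp: sgraph_def cedges_def)

lemma cedges_iff: "{x, y} \<in> cedges V E \<longleftrightarrow> x \<in> V \<and> y \<in> V \<and> x \<noteq> y \<and> {x, y} \<notin> E"
  by (auto simp: cedges_def card_2_iff doubleton_eq_iff)

lemma deg_cedges:
  assumes G: "sgraph V E" and "v \<in> V"
  shows "deg E v + deg (cedges V E) v = card V - 1"
proof -
  have finV: "finite V" using sgraph_finite_verts[OF G] .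
  have eq: "{y. {v, y} \<in> cedges V E} = (V - {v}) - {y. {v, y} \<in> E}"
    using assms by (auto simp: cedges_iff)
  have sub: "{y. {v, y} \<in> E} \<subseteq> V - {v}"
    using sgraph_edge_verts[OF G] sgraph_edge_neq[OF G] by blast
  then have "finite {y. {v, y} \<in> E}" using finV finite_subset by blast
  then have "deg (cedges V E) v = card (V - {v}) - deg E v"
    unfolding deg_eq_card_neighbours[OF G] deg_eq_card_neighbours[OF sgraph_cedges[OF G]] eq
    using sub by (rule card_Diff_subset)
  moreover have "deg E v \<le> card (V - {v})"
    unfolding deg_eq_card_neighbours[OF G] using sub finV by (intro card_mono) auto
  ultimately show ?thesis using assms finV by simp
qed

lemma card_edges_cedges:
  assumes G: "sgraph V E"
  shows "2 * card E + 2 * card (cedges V E) = card V * (card V - 1)"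
proof -
  have "2 * card E + 2 * card (cedges V E) = (\<Sum>v\<in>V. deg E v + deg (cedges V E) v)"
    by (simp add: sum.distrib sum_deg[OF G] sum_deg[OF sgraph_cedges[OF G]])
  also have "\<dots> = card V * (card V - 1)" by (simp add: deg_cedges[OF G])
  finally show ?thesis .
qed

lemma gconnected_deg_ge_1:
  assumes G: "sgraph V E" and "gconnected (V, E)" "card V \<ge> 2" "v \<in> V"
  shows "deg E v \<ge> 1"
proof -
  have "{v} \<subset> V" using assms by (auto simp: psubset_eq)
  then have "cut E {v} \<noteq> {}" using gconnected_imp_cut_nonempty[OF assms(2)] by blast
  then show ?thesis
    using sgraph_finite[OF G] by (simp add: cut_singleton[OF G] deg_def Suc_le_eq card_gt_0_iff)
qed

lemma gconnected_card_edges: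
  assumes G: "sgraph V E" and "gconnected (V, E)"
  shows "card V \<le> card E + 1"
proof -
  obtain r where "r \<in> V" using assms(2) by (auto simp: gconnected_def)
  then show ?thesis
    using card_le_edges_of_connected[OF sgraph_finite_verts[OF G] _ sgraph_finite[OF G]]
      gconnected_imp_cut_nonempty[OF assms(2)] G by (metis sgraph_def)
qed

lemma rd_ge_1:
  assumes G: "sgraph V E" and "E \<noteq> {}"
  shows "rd (V, E) \<ge> 1"
proof -
  obtain c where "c ` E \<subseteq> {1..rd (V, E)}" using rd_attained[OF G] .
  then show ?thesis using assms(2) by fastforce
qed

text \<open>In a connected complement every vertex has a neighbour, so no vertex of the graph is
  adjacent to all others.\<close>

lemma rd_le_card_minus_2:
  assumes G: "sgraph V E" and "V \<noteq> {}" "gconnected (gcomplement (V, E))" "card V \<ge> 2"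
  shows "rd (V, E) \<le> card V - 2"
proof -
  obtain x where "x \<in> V" using assms(2) by blast
  then show ?thesis
  proof (rule rd_le_of_degrees[OF G])
    fix v assume v: "v \<in> V"
    have "deg (cedges V E) v \<ge> 1"
      using gconnected_deg_ge_1[OF sgraph_cedges[OF G]] assms(3,4) v by (simp add: gcomplement_eq)
    then show "deg E v \<le> card V - 2" using deg_cedges[OF G v] by simp
  qed (use assms in auto)
qed

lemma rd_or_complement_le_card_minus_3:
  assumes G: "sgraph V E" and n: "card V \<ge> 4"
  shows "rd (V, E) \<le> card V - 3 \<or> rd (V, cedges V E) \<le> card V - 3"
proof (cases "\<exists>z\<in>V. \<exists>w\<in>V. z \<noteq> w \<and> deg E z > card V - 3 \<and> deg E w > card V - 3")
  case True
  then obtain z w where zw: "z \<in> V" "w \<in> V" "z \<noteq> w" "deg E z > card V - 3" "deg E w > card V - 3"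
    by blast
  have "deg (cedges V E) z \<le> 1" "deg (cedges V E) w \<le> 1"
    using deg_cedges[OF G zw(1)] deg_cedges[OF G zw(2)] zw(4,5) n by linarith+
  then show ?thesis using rd_le_two_leaves[OF sgraph_cedges[OF G] zw(1-3)] n by simp
next
  case False
  obtain x where "x \<in> V" "\<And>v. v \<in> V \<Longrightarrow> v \<noteq> x \<Longrightarrow> deg E v \<le> card V - 3"
  proof (cases "\<exists>x\<in>V. deg E x > card V - 3")
    case True
    then show ?thesis using that False by (meson not_le)
  next
    case no: False
    obtain x where "x \<in> V" using n by (metis card.empty ex_in_conv not_numeral_le_zero)
    then show ?thesis using that no by (meson not_le)
  qed
  then have "rd (V, E) \<le> card V - 3" using n by (intro rd_le_of_degrees[OF G]) auto
  then show ?thesis ..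
qed

lemma nordhaus_gaddum_rd:
  assumes G: "sgraph V E" and n: "card V = n" "n \<ge> 2"
    and conn: "gconnected (V, E)" "gconnected (gcomplement (V, E))"
  shows "int n - 2 \<le> int (rd (V, E)) + int (rd (gcomplement (V, E)))"
    and "int (rd (V, E)) + int (rd (gcomplement (V, E))) \<le> 2 * int n - 5"
    and "int n - 3 \<le> int (rd (V, E)) * int (rd (gcomplement (V, E)))"
    and "int (rd (V, E)) * int (rd (gcomplement (V, E))) \<le> (int n - 2) * (int n - 3)"
proof -
  define a where "a = rd (V, E)"
  define b where "b = rd (gcomplement (V, E))"
  have b: "b = rd (V, cedges V E)" by (simp add: b_def gcomplement_eq)
  note G' = sgraph_cedges[OF G]
  have conn': "gconnected (V, cedges V E)" using conn(2) by (simp add: gcomplement_eq)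
  have invol: "gcomplement (V, cedges V E) = (V, E)"
    using G by (auto simp: gcomplement_eq cedges_def sgraph_def)
  have ne: "V \<noteq> {}" using n by auto
  have sum: "2 * card E + 2 * card (cedges V E) = n * (n - 1)"
    using card_edges_cedges[OF G] n by simp
  have tree: "n - 1 \<le> card E" "n - 1 \<le> card (cedges V E)"
    using gconnected_card_edges[OF G conn(1)] gconnected_card_edges[OF G' conn'] n by auto
  \<comment> \<open>Two connected graphs share the \<open>n * (n - 1) / 2\<close> pairs and need
    \<open>n - 1\<close> edges each.\<close>
  then have "4 * (n - 1) \<le> n * (n - 1)" using sum by linarith
  then have n4: "n \<ge> 4" using n by simp
  have "E \<noteq> {}" "cedges V E \<noteq> {}" using tree n by auto
  then have ab1: "a \<ge> 1" "b \<ge> 1" using rd_ge_1[OF G] rd_ge_1[OF G'] by (auto simp: a_def b)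
  have "a \<le> n - 2" using rd_le_card_minus_2[OF G ne conn(2)] n by (simp add: a_def)
  moreover have "b \<le> n - 2" using rd_le_card_minus_2[OF G' ne] invol conn(1) n by (simp add: b)
  moreover have "a \<le> n - 3 \<or> b \<le> n - 3"
    using rd_or_complement_le_card_minus_3[OF G] n n4 by (simp add: a_def b)
  ultimately have up: "a \<le> n - 2 \<and> b \<le> n - 3 \<or> a \<le> n - 3 \<and> b \<le> n - 2" by auto
  \<comment> \<open>Mader's bound for the graph plus that for its complement; cancelling
    \<open>n - 1\<close> leaves the lower bound on the sum.\<close>
  have "n * (n - 1) \<le> (a + 1) * (n - 1) + (b + 1) * (n - 1)"
    using sum card_edges_le_rd[OF G ne] card_edges_le_rd[OF G' ne] n by (simp add: a_def b)
  also have "\<dots> = (a + b + 2) * (n - 1)" by (simp add: add_mult_distrib)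
  finally have "n * (n - 1) \<le> (a + b + 2) * (n - 1)" .
  from mult_le_cancel2[THEN iffD1, OF this] have low: "n \<le> a + b + 2" using n by simp
  show "int n - 2 \<le> int (rd (V, E)) + int (rd (gcomplement (V, E)))"
    using low by (simp add: a_def b_def)
  show "int (rd (V, E)) + int (rd (gcomplement (V, E))) \<le> 2 * int n - 5"
    using up n4 unfolding a_def[symmetric] b_def[symmetric] by linarith
  have "0 \<le> (int a - 1) * (int b - 1)" using ab1 by simp
  then have "int a + int b - 1 \<le> int a * int b" by (simp add: algebra_simps)
  then show "int n - 3 \<le> int (rd (V, E)) * int (rd (gcomplement (V, E)))"
    using low unfolding a_def[symmetric] b_def[symmetric] by linarith
  have "a * b \<le> (n - 2) * (n - 3)"
    using up mult_le_mono[of a "n - 2" b "n - 3"] mult_le_mono[of a "n - 3" b "n - 2"]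
    by (auto simp: mult.commute)
  then have "int (a * b) \<le> int ((n - 2) * (n - 3))" by (simp only: of_nat_le_iff)
  then show "int (rd (V, E)) * int (rd (gcomplement (V, E))) \<le> (int n - 2) * (int n - 3)"
    using n4 by (simp add: a_def b_def of_nat_diff)
qed

section \<open>Sharpness\<close>

lemma path_graph_4: "path_graph 4 = ({0..<4}, {{0, 1}, {1, 2}, {2, 3}})"
proof -
  have "{i. Suc i < 4} = {0, 1, 2}" by auto
  then have "{{i, Suc i} |i. Suc i < 4} = (\<lambda>i. {i, Suc i}) ` {0, 1, 2}"
    by (simp only: setcompr_eq_image)
  then show ?thesis by (simp add: path_graph_def numeral_2_eq_2 numeral_3_eq_3)
qed

lemma path_graph_4_complement:
  "gcomplement (path_graph 4) = ({0..<4}, {{0, 2}, {0, 3}, {1, 3}})"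
proof -
  have "{{0, 2}, {0, 3}, {1, 3}} \<subseteq> cedges {0..<4} {{0, 1}, {1, 2}, {2, 3::nat}}"
    by (simp add: cedges_iff doubleton_eq_iff)
  moreover have "e \<in> {{0, 2}, {0, 3}, {1, 3}}" if e': "e \<in> cedges {0..<4} {{0, 1}, {1, 2}, {2, 3::nat}}" for e
  proof -
    obtain x y where e: "e = {x, y}" using e' by (auto simp: cedges_def card_2_iff)
    have xy: "x < 4" "y < 4" "x \<noteq> y" "{x, y} \<notin> {{0, 1}, {1, 2}, {2, 3::nat}}"
      using e' unfolding e cedges_iff by simp_all
    then have "x = 0 \<or> x = 1 \<or> x = 2 \<or> x = 3" "y = 0 \<or> y = 1 \<or> y = 2 \<or> y = 3" by linarith+
    then show ?thesis using xy(3,4) unfolding e by (elim disjE) (simp_all add: doubleton_eq_iff)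
  qed
  ultimately have "cedges {0..<4} {{0, 1}, {1, 2}, {2, 3::nat}} = {{0, 2}, {0, 3}, {1, 3}}"
    by (intro equalityI subsetI) (assumption, rule subsetD)
  then show ?thesis unfolding path_graph_4 gcomplement_eq by simp
qed

lemma path_graph_4_self_complementary: "graph_iso (path_graph 4) (gcomplement (path_graph 4))"
proof -
  \<comment> \<open>The complement is the path 1, 3, 0, 2, and \<open>f\<close> lists its vertices
    in this order.\<close>
  define f where "f = (\<lambda>i::nat. if i = 0 then 1 else if i = 1 then 3 else if i = 2 then 0 else 2::nat)"
  have V: "{0..<4} = {0, 1, 2, 3::nat}" by auto
  have "bij_betw f {0..<4} {0..<4}" unfolding V by (auto simp: bij_betw_def inj_on_def f_def)
  moreover have "\<forall>u\<in>{0..<4}. \<forall>v\<in>{0..<4}.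
      {u, v} \<in> {{0, 1}, {1, 2}, {2, 3::nat}} \<longleftrightarrow> {f u, f v} \<in> {{0, 2}, {0, 3}, {1, 3}}"
    unfolding V by (simp add: f_def doubleton_eq_iff)
  ultimately show ?thesis
    unfolding graph_iso_def path_graph_4_complement by (auto simp: path_graph_4)
qed

text \<open>Both graphs have two leaves, so the bound \<open>card V - 3\<close> equals 1
  here.\<close>

lemma path_graph_4_rd:
  defines "G \<equiv> path_graph 4"
  shows "simple_graph G" "gconnected G" "gconnected (gcomplement G)"
    and "rd G = 1" "rd (gcomplement G) = 1"
proof -
  define E where "E = {{0, 1}, {1, 2}, {2, 3::nat}}"
  define E' where "E' = {{0, 2}, {0, 3}, {1, 3::nat}}"
  have V: "{0..<4} = {0, 1, 2, 3::nat}" by auto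
  have G: "G = ({0..<4}, E)" by (simp add: G_def path_graph_4 E_def)
  have G': "gcomplement G = ({0..<4}, E')" by (simp add: G_def path_graph_4_complement E'_def)
  have sg: "sgraph {0..<4} E" "sgraph {0..<4} E'" by (auto simp: sgraph_def E_def E'_def)
  then show "simple_graph G" by (simp add: G simple_graph_iff_sgraph)
  have e: "same_component ({0..<4}, E) 0 1" "same_component ({0..<4}, E) 1 2"
      "same_component ({0..<4}, E) 2 3"
    by (rule same_component_edge, simp add: E_def)+
  have "same_component ({0..<4}, E) 0 v" if "v \<in> {0..<4}" for v
    using that e same_component_trans[OF e(1,2)] same_component_trans[OF same_component_trans[OF e(1,2)] e(3)]
    unfolding V by (auto simp: same_component_def)
  then show conn: "gconnected G" unfolding G by (intro gconnected_rootI[of 0]) auto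
  have f: "same_component ({0..<4}, E') 0 2" "same_component ({0..<4}, E') 0 3"
      "same_component ({0..<4}, E') 3 1"
    by (rule same_component_edge, simp add: E'_def insert_commute)+
  have "same_component ({0..<4}, E') 0 v" if "v \<in> {0..<4}" for v
    using that f same_component_trans[OF f(2,3)] unfolding V by (auto simp: same_component_def)
  then show conn': "gconnected (gcomplement G)" unfolding G' by (intro gconnected_rootI[of 0]) auto
  have leaf: "deg F v \<le> 1" if "{e \<in> F. v \<in> e} \<subseteq> {e}" for F v and e :: "nat set"
    unfolding deg_def using card_mono[OF _ that] by simp
  have "deg E 0 \<le> 1" "deg E 3 \<le> 1" by (rule leaf[of _ _ "{0, 1}"] leaf[of _ _ "{2, 3}"], force simp: E_def)+
  then have "rd ({0..<4}, E) \<le> card {0..<4::nat} - 3"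
    by (intro rd_le_two_leaves[OF sg(1), of 0 3]) auto
  moreover have "E \<noteq> {}" "E' \<noteq> {}" by (auto simp: E_def E'_def)
  ultimately show "rd G = 1" using rd_ge_1[OF sg(1)] by (simp add: G)
  have "deg E' 1 \<le> 1" "deg E' 2 \<le> 1" by (rule leaf[of _ _ "{1, 3}"] leaf[of _ _ "{0, 2}"], force simp: E'_def)+
  then have "rd ({0..<4}, E') \<le> card {0..<4::nat} - 3"
    by (intro rd_le_two_leaves[OF sg(2), of 1 2]) auto
  then show "rd (gcomplement G) = 1" using rd_ge_1[OF sg(2)] \<open>E' \<noteq> {}\<close> by (simp add: G')
qed

text \<open>The vertices 0 and 1 are adjacent to each other and to all vertices except 2, which is pendant
  at 3. In the complement, 4 and 5 are adjacent to each other and to all vertices except 0 and 1.\<close>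

definition extremal_edges :: "nat \<Rightarrow> nat set set" where
  "extremal_edges n = {{0, 1}, {2, 3}} \<union> {{0, i} |i. 3 \<le> i \<and> i < n} \<union> {{1, i} |i. 3 \<le> i \<and> i < n}"

text \<open>The adjacent vertices 0 and 1 have \<open>n - 3\<close> common neighbours; in the
  complement, 4 and 5 have \<open>n - 4\<close>. This gives the lower bounds \<open>n - 2\<close>
  and \<open>n - 3\<close>, whose sum already is the general upper bound \<open>2 * n - 5\<close>,
  so both are equalities.\<close>

lemma extremal_graph:
  assumes n: "n \<ge> 6"
  defines "G \<equiv> ({0..<n}, extremal_edges n)"
  shows "simple_graph G" "gconnected G" "gconnected (gcomplement G)"
    and "rd G = n - 2" "rd (gcomplement G) = n - 3"
proof -
  let ?V = "{0..<n}" and ?E = "extremal_edges n"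
  let ?E' = "cedges ?V ?E"
  have sg: "sgraph ?V ?E" using n by (auto simp: sgraph_def extremal_edges_def)
  note sg' = sgraph_cedges[OF sg]
  have G': "gcomplement G = (?V, ?E')" by (simp add: G_def gcomplement_eq)
  have E01: "{0, 1} \<in> ?E" "{2, 3} \<in> ?E" by (auto simp: extremal_edges_def)
  have Ei: "{0, i} \<in> ?E" "{1, i} \<in> ?E" if "3 \<le> i" "i < n" for i
    using that by (auto simp: extremal_edges_def)
  have E': "{x, y} \<in> ?E'" if "2 \<le> x" "x < y" "y < n" "x \<noteq> 2 \<or> y \<noteq> 3" for x y
    using that by (auto simp: cedges_iff extremal_edges_def doubleton_eq_iff)
  have E'2: "{2, 0} \<in> ?E'" "{2, 1} \<in> ?E'"
    using n by (auto simp: cedges_iff extremal_edges_def doubleton_eq_iff)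
  show "simple_graph G" using sg by (simp add: G_def simple_graph_iff_sgraph)
  show conn: "gconnected G" unfolding G_def
  proof (rule gconnected_rootI[of 0])
    fix v assume v: "v \<in> {0..<n}"
    have "same_component (?V, ?E) 0 3" "same_component (?V, ?E) 3 2"
      using Ei[of 3] E01 n by (auto intro!: same_component_edge simp: insert_commute)
    then have two: "same_component (?V, ?E) 0 2" by (rule same_component_trans)
    consider "v = 0" | "v = 1" | "v = 2" | "3 \<le> v" by linarith
    then show "same_component (?V, ?E) 0 v"
    proof cases
      case 1
      then show ?thesis by (simp add: same_component_def)
    next
      case 2
      then show ?thesis using E01 by (auto intro: same_component_edge)
    next
      case 3
      then show ?thesis using two by simp
    next
      case 4
      then show ?thesis using Ei v by (auto intro: same_component_edge)
    qed
  qed (use n in auto)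
  show conn': "gconnected (gcomplement G)" unfolding G'
  proof (rule gconnected_rootI[of 2])
    fix v assume v: "v \<in> {0..<n}"
    have "same_component (?V, ?E') 2 4" "same_component (?V, ?E') 4 3"
      using E'[of 2 4] E'[of 3 4] n by (auto intro!: same_component_edge simp: insert_commute)
    then have three: "same_component (?V, ?E') 2 3" by (rule same_component_trans)
    consider "v = 2" | "v = 0" | "v = 1" | "v = 3" | "4 \<le> v" by linarith
    then show "same_component (?V, ?E') 2 v"
    proof cases
      case 1
      then show ?thesis by (simp add: same_component_def)
    next
      case 2
      then show ?thesis using E'2 by (auto intro: same_component_edge)
    next
      case 3
      then show ?thesis using E'2 by (auto intro: same_component_edge)
    next
      case 4
      then show ?thesis using three by simp
    next
      case 5
      then show ?thesis using E'[of 2 v] v by (auto intro: same_component_edge)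
    qed
  qed (use n in auto)
  have "card {3..<n} < rd G" unfolding G_def
    using Ei by (intro card_common_neighbours_less_rd[OF sg E01(1)]) auto
  then have lowG: "n - 2 \<le> rd G" using n by simp
  have "card ({2, 3} \<union> {6..<n}) < rd (gcomplement G)" unfolding G'
  proof (rule card_common_neighbours_less_rd[OF sg', of 4 5])
    show "{4, 5} \<in> ?E'" using E'[of 4 5] n by simp
    fix m assume "m \<in> {2, 3} \<union> {6..<n}"
    then consider "m = 2 \<or> m = 3" | "6 \<le> m" "m < n" by auto
    then show "{4, m} \<in> ?E' \<and> {5, m} \<in> ?E'"
    proof cases
      case 1
      then show ?thesis using E'[of m 4] E'[of m 5] n by (auto simp: insert_commute)
    next
      case 2
      then show ?thesis using E'[of 4 m] E'[of 5 m] by simp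
    qed
  qed
  moreover have "card ({2, 3} \<union> {6..<n}) = n - 4" using n by (subst card_Un_disjoint) auto
  ultimately have "n - 3 \<le> rd (gcomplement G)" using n by simp
  moreover have "int (rd G) + int (rd (gcomplement G)) \<le> 2 * int n - 5"
    using nordhaus_gaddum_rd(2)[OF sg, of n] conn conn' n by (simp add: G_def)
  ultimately show "rd G = n - 2" "rd (gcomplement G) = n - 3" using lowG n by linarith+
qed

theorem theorem7:
  "(\<forall>(G :: 'a ugraph) n.
      simple_graph G \<and> card (gverts G) = n \<and> n \<ge> 2 \<and>
      gconnected G \<and> gconnected (gcomplement G) \<longrightarrow>
        int n - 2 \<le> int (rd G) + int (rd (gcomplement G)) \<and>
        int (rd G) + int (rd (gcomplement G)) \<le> 2 * int n - 5 \<and>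
        int n - 3 \<le> int (rd G) * int (rd (gcomplement G)) \<and>
        int (rd G) * int (rd (gcomplement G)) \<le> (int n - 2) * (int n - 3))
   \<and> (let G = path_graph 4; n = card (gverts G) in
        simple_graph G \<and> gconnected G \<and> gconnected (gcomplement G) \<and>
        graph_iso G (gcomplement G) \<and>
        int (rd G) + int (rd (gcomplement G)) = int n - 2 \<and>
        int (rd G) * int (rd (gcomplement G)) = int n - 3)
   \<and> (\<forall>n\<ge>6. \<exists>G :: nat ugraph.
        simple_graph G \<and> card (gverts G) = n \<and>
        gconnected G \<and> gconnected (gcomplement G) \<and>
        int (rd G) + int (rd (gcomplement G)) = 2 * int n - 5 \<and>
        int (rd G) * int (rd (gcomplement G)) = (int n - 2) * (int n - 3))"
proof (intro conjI)
  show "\<forall>(G :: 'a ugraph) n.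
      simple_graph G \<and> card (gverts G) = n \<and> n \<ge> 2 \<and>
      gconnected G \<and> gconnected (gcomplement G) \<longrightarrow>
        int n - 2 \<le> int (rd G) + int (rd (gcomplement G)) \<and>
        int (rd G) + int (rd (gcomplement G)) \<le> 2 * int n - 5 \<and>
        int n - 3 \<le> int (rd G) * int (rd (gcomplement G)) \<and>
        int (rd G) * int (rd (gcomplement G)) \<le> (int n - 2) * (int n - 3)"
  proof (intro allI impI, elim conjE)
    fix G :: "'a ugraph" and n
    assume A: "simple_graph G" "card (gverts G) = n" "n \<ge> 2"
      "gconnected G" "gconnected (gcomplement G)"
    obtain V E where G: "G = (V, E)" by (cases G)
    show "int n - 2 \<le> int (rd G) + int (rd (gcomplement G)) \<and>
        int (rd G) + int (rd (gcomplement G)) \<le> 2 * int n - 5 \<and>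
        int n - 3 \<le> int (rd G) * int (rd (gcomplement G)) \<and>
        int (rd G) * int (rd (gcomplement G)) \<le> (int n - 2) * (int n - 3)"
      using nordhaus_gaddum_rd[of V E n] A unfolding G by (simp add: simple_graph_iff_sgraph)
  qed
  have "card (gverts (path_graph 4)) = 4" by (simp add: path_graph_def)
  then show "let G = path_graph 4; n = card (gverts G) in
        simple_graph G \<and> gconnected G \<and> gconnected (gcomplement G) \<and>
        graph_iso G (gcomplement G) \<and>
        int (rd G) + int (rd (gcomplement G)) = int n - 2 \<and>
        int (rd G) * int (rd (gcomplement G)) = int n - 3"
    using path_graph_4_rd path_graph_4_self_complementary by (simp add: Let_def)
  show "\<forall>n\<ge>6. \<exists>G :: nat ugraph.
        simple_graph G \<and> card (gverts G) = n \<and>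
        gconnected G \<and> gconnected (gcomplement G) \<and>
        int (rd G) + int (rd (gcomplement G)) = 2 * int n - 5 \<and>
        int (rd G) * int (rd (gcomplement G)) = (int n - 2) * (int n - 3)"
  proof (intro allI impI)
    fix n :: nat assume n: "n \<ge> 6"
    let ?G = "({0..<n}, extremal_edges n)"
    have "int (n - 2) + int (n - 3) = 2 * int n - 5"
      "int (n - 2) * int (n - 3) = (int n - 2) * (int n - 3)"
      using n by (simp_all add: of_nat_diff)
    then show "\<exists>G :: nat ugraph.
        simple_graph G \<and> card (gverts G) = n \<and>
        gconnected G \<and> gconnected (gcomplement G) \<and>
        int (rd G) + int (rd (gcomplement G)) = 2 * int n - 5 \<and>
        int (rd G) * int (rd (gcomplement G)) = (int n - 2) * (int n - 3)"
      using extremal_graph[OF n] by (intro exI[of _ ?G]) simp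
  qed
qed

end
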